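(* Let $0<\beta<1$ and $0<\zeta/\alpha<2$. Let $u$ be a vertex of $\mathcal{G}(N;\zeta,\alpha,\beta)$ with type $t_u\le\zeta R/(2\alpha)$. Then for any $\varepsilon>0$, conditionally on $t_u$, $$D_u\stackrel{\Delta}{=}(1\pm\varepsilon)\,\mathsf{Bin}\left(N-1,\ K\left(\frac{e^{\zeta t_u/2}}{N}\right)^{\beta}\right),$$ where $K=\frac{1}{\sqrt{\pi}}\cdot\frac{2\alpha}{2\alpha-\beta\zeta}\cdot\frac{\Gamma\left(\frac{1-\beta}{2}\right)}{\Gamma\left(1-\frac{\beta}{2}\right)}$.
   Context: Model $\mathcal{G}(N;\zeta,\alpha,\beta)$: fix $0<\zeta<2$, $\alpha>0$, $\beta>0$. For a positive integer $N$ let $R$ be defined by $N=e^{\zeta R/2}$. Work in the native representation of the hyperbolic plane of curvature $-\zeta^2$: points of $\mathbb{R}^2$ in polar coordinates $(r,\theta)$, where $r$ is the hyperbolic distance from the origin, and the hyperbolic distance between $u=(r_u,\theta_u)$, $v=(r_v,\theta_v)$ is given by $\cosh(\zeta d(u,v))=\cosh(\zeta r_u)\cosh(\zeta r_v)-\sinh(\zeta r_u)\sinh(\zeta r_v)\cos(\theta_{u,v})$, $\theta_{u,v}\in[0,\pi]$ the relative angle. The vertex set consists of $N$ independent random points in the disc of radius $R$ about the origin, each with angle uniform on $(0,2\pi]$ and, independently, radius with density $\rho(r)=\alpha\frac{\sinh(\alpha r)}{\cosh(\alpha R)-1}$ on $[0,R]$. Given the positions, each pair of distinct vertices $u,v$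 is joined independently with probability $p_{u,v}=\frac{1}{\exp\left(\beta\frac{\zeta}{2}(d(u,v)-R)\right)+1}$. $D_u$ is the degree of $u$. The type of a vertex $v$ is $t_v=R-r_v$. For a random variable $X$, $X\stackrel{\Delta}{=}(1\pm\varepsilon)\mathsf{Bin}(n,p)$ means that the distribution of $X$ is stochastically between $\mathsf{Bin}(n,(1-\varepsilon)p)$ and $\mathsf{Bin}(n,(1+\varepsilon)p)$ (here asymptotically, for $N$ large). *)

theory Defs
  imports "HOL-Probability.Probability"
begin

section \<open>The hyperbolic disc\<close>

text \<open>A point is given by its native polar coordinates \<open>(r, \<theta>)\<close>. The radius \<open>R\<close> of the disc
  is determined by \<open>N = exp (\<zeta> R / 2)\<close>.\<close>

definition disc_radius :: "real \<Rightarrow> nat \<Rightarrow> real" where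
  "disc_radius \<zeta> N = 2 / \<zeta> * ln (real N)"

text \<open>For \<open>a, b \<in> (0, 2\<pi>]\<close> this lies in \<open>[0, \<pi>]\<close>.\<close>

definition rel_angle :: "real \<Rightarrow> real \<Rightarrow> real" where
  "rel_angle a b = min \<bar>a - b\<bar> (2 * pi - \<bar>a - b\<bar>)"

definition hyp_dist :: "real \<Rightarrow> real \<times> real \<Rightarrow> real \<times> real \<Rightarrow> real" where
  "hyp_dist \<zeta> x y =
     arcosh (cosh (\<zeta> * fst x) * cosh (\<zeta> * fst y)
       - sinh (\<zeta> * fst x) * sinh (\<zeta> * fst y) * cos (rel_angle (snd x) (snd y))) / \<zeta>"

definition conn_prob :: "nat \<Rightarrow> real \<Rightarrow> real \<Rightarrow> real \<times> real \<Rightarrow> real \<times> real \<Rightarrow> real" where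
  "conn_prob N \<zeta> \<beta> x y = 1 / (exp (\<beta> * (\<zeta> / 2) * (hyp_dist \<zeta> x y - disc_radius \<zeta> N)) + 1)"


section \<open>The random graph\<close>

definition radius_density :: "nat \<Rightarrow> real \<Rightarrow> real \<Rightarrow> real \<Rightarrow> real" where
  "radius_density N \<zeta> \<alpha> r =
     \<alpha> * (sinh (\<alpha> * r) / (cosh (\<alpha> * disc_radius \<zeta> N) - 1)) * indicator {0..disc_radius \<zeta> N} r"

definition vertex_law :: "nat \<Rightarrow> real \<Rightarrow> real \<Rightarrow> (real \<times> real) measure" where
  "vertex_law N \<zeta> \<alpha> =
     density lborel (\<lambda>r. ennreal (radius_density N \<zeta> \<alpha> r)) \<Otimes>\<^sub>M uniform_measure lborel {0<..2 * pi}"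

definition positions :: "nat \<Rightarrow> real \<Rightarrow> real \<Rightarrow> (nat \<Rightarrow> real \<times> real) measure" where
  "positions N \<zeta> \<alpha> = (\<Pi>\<^sub>M v\<in>{..<N}. vertex_law N \<zeta> \<alpha>)"

text \<open>The vertices are \<open>0, \<dots>, N - 1\<close>; the unordered pair of distinct vertices \<open>u\<close>, \<open>v\<close> is
  represented by the ordered pair whose first component is the smaller one.\<close>

definition vertex_pairs :: "nat \<Rightarrow> (nat \<times> nat) set" where
  "vertex_pairs N = {(i, j). i < j \<and> j < N}"

definition edges_given ::
  "nat \<Rightarrow> real \<Rightarrow> real \<Rightarrow> (nat \<Rightarrow> real \<times> real) \<Rightarrow> (nat \<times> nat \<Rightarrow> bool) pmf" where
  "edges_given N \<zeta> \<beta> x =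
     Pi_pmf (vertex_pairs N) False (\<lambda>(i, j). bernoulli_pmf (conn_prob N \<zeta> \<beta> (x i) (x j)))"

definition hyp_graph ::
  "nat \<Rightarrow> real \<Rightarrow> real \<Rightarrow> real \<Rightarrow> ((nat \<Rightarrow> real \<times> real) \<times> (nat \<times> nat \<Rightarrow> bool)) measure" where
  "hyp_graph N \<zeta> \<alpha> \<beta> =
     positions N \<zeta> \<alpha> \<bind>
       (\<lambda>x. distr (measure_pmf (edges_given N \<zeta> \<beta> x))
              (positions N \<zeta> \<alpha> \<Otimes>\<^sub>M count_space UNIV) (\<lambda>E. (x, E)))"

definition adjacent :: "(nat \<Rightarrow> real \<times> real) \<times> (nat \<times> nat \<Rightarrow> bool) \<Rightarrow> nat \<Rightarrow> nat \<Rightarrow> bool" where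
  "adjacent G u v \<longleftrightarrow> u \<noteq> v \<and> snd G (min u v, max u v)"

definition vertex_degree ::
  "nat \<Rightarrow> nat \<Rightarrow> (nat \<Rightarrow> real \<times> real) \<times> (nat \<times> nat \<Rightarrow> bool) \<Rightarrow> nat" where
  "vertex_degree N u G = card {v. v < N \<and> adjacent G u v}"

definition vertex_type ::
  "nat \<Rightarrow> real \<Rightarrow> nat \<Rightarrow> (nat \<Rightarrow> real \<times> real) \<times> (nat \<times> nat \<Rightarrow> bool) \<Rightarrow> real" where
  "vertex_type N \<zeta> u G = disc_radius \<zeta> N - fst (fst G u)"


section \<open>Conditional distributions and stochastic domination\<close>

text \<open>A version of the conditional probability \<open>P(X \<ge> k | Y)\<close>.\<close>

definition cond_tail ::
  "'a measure \<Rightarrow> ('a \<Rightarrow> real) \<Rightarrow> ('a \<Rightarrow> nat) \<Rightarrow> 'a \<Rightarrow> nat \<Rightarrow> real" where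
  "cond_tail M Y X \<omega> k =
     real_cond_exp M (vimage_algebra (space M) Y borel) (indicator {\<omega>' \<in> space M. k \<le> X \<omega>'}) \<omega>"

text \<open>The library's \<^const>\<open>binomial_pmf\<close> is unspecified for parameters outside \<open>[0, 1]\<close>, such as
  \<open>(1 - \<epsilon>) p\<close> with \<open>\<epsilon> > 1\<close>; these are truncated to \<open>[0, 1]\<close>.\<close>

definition Bin :: "nat \<Rightarrow> real \<Rightarrow> nat pmf" where
  "Bin n p = binomial_pmf n (max 0 (min 1 p))"

text \<open>The law on the natural numbers with tail function \<open>k \<mapsto> T k = P(X \<ge> k)\<close> lies stochastically
  between \<open>Bin(n, (1 - \<epsilon>) p)\<close> and \<open>Bin(n, (1 + \<epsilon>) p)\<close>.\<close>

definition approx_Bin :: "(nat \<Rightarrow> real) \<Rightarrow> real \<Rightarrow> nat \<Rightarrow> real \<Rightarrow> bool" where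
  "approx_Bin T \<epsilon> n p \<longleftrightarrow>
     (\<forall>k. measure_pmf.prob (Bin n ((1 - \<epsilon>) * p)) {k..} \<le> T k \<and>
          T k \<le> measure_pmf.prob (Bin n ((1 + \<epsilon>) * p)) {k..})"

definition K_const :: "real \<Rightarrow> real \<Rightarrow> real \<Rightarrow> real" where
  "K_const \<zeta> \<alpha> \<beta> =
     1 / sqrt pi * (2 * \<alpha> / (2 * \<alpha> - \<beta> * \<zeta>)) * (Gamma ((1 - \<beta>) / 2) / Gamma (1 - \<beta> / 2))"


section \<open>Well-definedness\<close>

lemma exp_disc_radius:
  assumes "0 < \<zeta>" "0 < N"
  shows "exp (\<zeta> * disc_radius \<zeta> N / 2) = real N"
  using assms by (simp add: disc_radius_def)

lemma cos_rel_angle: "cos (rel_angle a b) = cos (a - b)"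
  by (auto simp: rel_angle_def min_def cos_diff abs_if cos_add)

lemma cosh_hyp_dist:
  assumes "0 < \<zeta>" "0 \<le> fst x" "0 \<le> fst y"
  shows "cosh (\<zeta> * hyp_dist \<zeta> x y) =
    cosh (\<zeta> * fst x) * cosh (\<zeta> * fst y)
      - sinh (\<zeta> * fst x) * sinh (\<zeta> * fst y) * cos (rel_angle (snd x) (snd y))"
proof -
  let ?s = "sinh (\<zeta> * fst x) * sinh (\<zeta> * fst y)"
  have s: "0 \<le> ?s" using assms by simp
  have "?s * cos (rel_angle (snd x) (snd y)) \<le> ?s * 1"
    by (rule mult_left_mono[OF cos_le_one s])
  moreover have "cosh (\<zeta> * fst x) * cosh (\<zeta> * fst y) - ?s = cosh (\<zeta> * fst x - \<zeta> * fst y)"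
    by (simp add: cosh_diff)
  moreover have "1 \<le> cosh (\<zeta> * fst x - \<zeta> * fst y)" by (rule cosh_real_ge_1)
  ultimately have "1 \<le> cosh (\<zeta> * fst x) * cosh (\<zeta> * fst y)
      - ?s * cos (rel_angle (snd x) (snd y))" by linarith
  then show ?thesis using assms(1) by (simp add: hyp_dist_def)
qed

lemma prob_space_radius:
  assumes "0 < \<zeta>" "0 < \<alpha>" "1 < N"
  shows "prob_space (density lborel (\<lambda>r. ennreal (radius_density N \<zeta> \<alpha> r)))"
proof -
  let ?R = "disc_radius \<zeta> N"
  have R: "0 < ?R" using assms by (simp add: disc_radius_def)
  then have c: "cosh (\<alpha> * ?R) > 1" using assms cosh_real_strict_mono[of 0 "\<alpha> * ?R"] by simp
  have "(\<integral>\<^sup>+ r. ennreal (radius_density N \<zeta> \<alpha> r) \<partial>lborel) =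
    (\<integral>\<^sup>+ r. ennreal (\<alpha> * (sinh (\<alpha> * r) / (cosh (\<alpha> * ?R) - 1))) * indicator {0..?R} r \<partial>lborel)"
    unfolding radius_density_def
    by (intro nn_integral_cong) (auto split: split_indicator)
  also have "\<dots> = ennreal (cosh (\<alpha> * ?R) / (cosh (\<alpha> * ?R) - 1) - cosh (\<alpha> * 0) / (cosh (\<alpha> * ?R) - 1))"
    using R assms c
    by (intro nn_integral_FTC_Icc)
       (auto intro!: derivative_eq_intros continuous_intros borel_measurable_continuous_onI divide_nonneg_nonneg mult_nonneg_nonneg)
  also have "\<dots> = 1" using c R assms by (simp add: diff_divide_distrib[symmetric])
  finally have "(\<integral>\<^sup>+ r. ennreal (radius_density N \<zeta> \<alpha> r) \<partial>lborel) = 1" .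
  moreover have "radius_density N \<zeta> \<alpha> \<in> borel_measurable borel"
    unfolding radius_density_def sinh_field_def by measurable
  ultimately show ?thesis
    by (intro prob_spaceI) (simp add: emeasure_density)
qed

lemma prob_space_positions:
  assumes "0 < \<zeta>" "0 < \<alpha>" "1 < N"
  shows "prob_space (positions N \<zeta> \<alpha>)"
proof -
  interpret A: prob_space "density lborel (\<lambda>r. ennreal (radius_density N \<zeta> \<alpha> r))"
    by (rule prob_space_radius[OF assms])
  interpret B: prob_space "uniform_measure lborel {0<..2 * pi}"
    by (intro prob_space_uniform_measure) auto
  interpret pair_prob_space "density lborel (\<lambda>r. ennreal (radius_density N \<zeta> \<alpha> r))"
    "uniform_measure lborel {0<..2 * pi}" ..
  show ?thesis unfolding positions_def vertex_law_def
    by (intro prob_space_PiM) (rule prob_space_axioms)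
qed

lemma sets_vertex_law: "sets (vertex_law N \<zeta> \<alpha>) = sets (borel \<Otimes>\<^sub>M borel)"
  unfolding vertex_law_def by (intro sets_pair_measure_cong) auto

lemma conn_prob_measurable:
  assumes "i < N" "j < N"
  shows "(\<lambda>x. conn_prob N \<zeta> \<beta> (x i) (x j)) \<in> borel_measurable (positions N \<zeta> \<alpha>)"
proof -
  have c: "(\<lambda>x. x v) \<in> positions N \<zeta> \<alpha> \<rightarrow>\<^sub>M borel \<Otimes>\<^sub>M borel" if "v < N" for v
    using measurable_component_singleton[of v "{..<N}" "\<lambda>_. vertex_law N \<zeta> \<alpha>"] that
      measurable_cong_sets[OF refl sets_vertex_law]
    unfolding positions_def by blast
  note [measurable] = c[OF assms(1)] c[OF assms(2)]
  show ?thesis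
    unfolding conn_prob_def hyp_dist_def cos_rel_angle arcosh_def sinh_field_def cosh_field_def
    by measurable
qed

lemma finite_vertex_pairs: "finite (vertex_pairs N)"
  by (rule finite_subset[of _ "{..<N} \<times> {..<N}"]) (auto simp: vertex_pairs_def)

lemma edges_kernel_measurable:
  "(\<lambda>x. distr (measure_pmf (edges_given N \<zeta> \<beta> x))
      (positions N \<zeta> \<alpha> \<Otimes>\<^sub>M count_space UNIV) (\<lambda>E. (x, E)))
   \<in> positions N \<zeta> \<alpha> \<rightarrow>\<^sub>M prob_algebra (positions N \<zeta> \<alpha> \<Otimes>\<^sub>M count_space UNIV)"
proof -
  let ?P = "positions N \<zeta> \<alpha>"
  let ?F = "PiE_dflt (vertex_pairs N) False (\<lambda>_. UNIV :: bool set)"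
  have fin: "finite ?F" by (intro finite_PiE_dflt finite_vertex_pairs) auto
  have pmf_meas: "(\<lambda>x. pmf (edges_given N \<zeta> \<beta> x) E) \<in> borel_measurable ?P" for E
  proof -
    have "(\<lambda>x. pmf (case e of (i, j) \<Rightarrow> bernoulli_pmf (conn_prob N \<zeta> \<beta> (x i) (x j))) (E e))
        \<in> borel_measurable ?P" if e: "e \<in> vertex_pairs N" for e
    proof -
      obtain i j where ij: "e = (i, j)" "i < N" "j < N"
        using e by (auto simp: vertex_pairs_def)
      note [measurable] = conn_prob_measurable[OF ij(2,3), of \<zeta> \<beta> \<alpha>]
      show ?thesis by (simp add: ij(1) bernoulli_pmf.rep_eq)
    qed
    then show ?thesis
      unfolding edges_given_def pmf_Pi[OF finite_vertex_pairs]
      by (cases "\<forall>x. x \<notin> vertex_pairs N \<longrightarrow> E x = False") (auto intro!: borel_measurable_prod)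
  qed
  have kernel: "(\<lambda>x. measure_pmf (edges_given N \<zeta> \<beta> x)) \<in> ?P \<rightarrow>\<^sub>M subprob_algebra (count_space UNIV)"
  proof (rule measurable_subprob_algebra)
    fix A :: "(nat \<times> nat \<Rightarrow> bool) set"
    have "emeasure (edges_given N \<zeta> \<beta> x) A = (\<Sum>E\<in>A \<inter> ?F. ennreal (pmf (edges_given N \<zeta> \<beta> x) E))" for x
    proof -
      have "set_pmf (edges_given N \<zeta> \<beta> x) \<subseteq> ?F"
        using set_Pi_pmf_subset[OF finite_vertex_pairs]
        unfolding edges_given_def PiE_dflt_def by fastforce
      then have "emeasure (edges_given N \<zeta> \<beta> x) A = emeasure (edges_given N \<zeta> \<beta> x) (A \<inter> ?F)"
        by (intro emeasure_eq_AE) (auto simp: AE_measure_pmf_iff)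
      then show ?thesis using fin by (simp add: emeasure_measure_pmf_finite)
    qed
    then show "(\<lambda>x. emeasure (edges_given N \<zeta> \<beta> x) A) \<in> borel_measurable ?P"
      using pmf_meas by simp
  qed (auto intro: measure_pmf.subprob_space_axioms)
  show ?thesis
  proof (rule measurable_prob_algebraI)
    show "(\<lambda>x. distr (measure_pmf (edges_given N \<zeta> \<beta> x)) (?P \<Otimes>\<^sub>M count_space UNIV) (\<lambda>E. (x, E)))
      \<in> ?P \<rightarrow>\<^sub>M subprob_algebra (?P \<Otimes>\<^sub>M count_space UNIV)"
      by (rule measurable_distr2[OF _ kernel]) (simp add: case_prod_eta)
    fix x assume "x \<in> space ?P"
    then have "(\<lambda>E. (x, E)) \<in> measure_pmf (edges_given N \<zeta> \<beta> x) \<rightarrow>\<^sub>M ?P \<Otimes>\<^sub>M count_space UNIV"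
      by (auto simp: space_pair_measure)
    then show "prob_space (distr (measure_pmf (edges_given N \<zeta> \<beta> x))
        (?P \<Otimes>\<^sub>M count_space UNIV) (\<lambda>E. (x, E)))"
      by (rule measure_pmf.prob_space_distr)
  qed
qed

lemma prob_space_hyp_graph:
  assumes "0 < \<zeta>" "0 < \<alpha>" "1 < N"
  shows "prob_space (hyp_graph N \<zeta> \<alpha> \<beta>)"
proof -
  have "positions N \<zeta> \<alpha> \<in> space (prob_algebra (positions N \<zeta> \<alpha>))"
    using prob_space_positions[OF assms] by (simp add: space_prob_algebra)
  from prob_space_bind'[OF this edges_kernel_measurable]
  show ?thesis by (simp add: hyp_graph_def)
qed

end

theory Submission
  imports Defs "HOL-Real_Asymp.Real_Asymp"
begin

text \<open>Given the position of \<open>u\<close>, the other vertices are joined to \<open>u\<close> independently, each with the same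
  probability \<open>q\<close>, and by rotation invariance \<open>q\<close> depends only on the radius \<open>r\<close> of \<open>u\<close>. So given the
  type, the degree of \<open>u\<close> is exactly \<open>Bin(N - 1, q(r))\<close>, and since binomial tails increase with the
  success probability it suffices to show \<open>q(r) \<sim> K exp(-\<beta>\<zeta>r/2)\<close> uniformly in \<open>r \<ge> (1 - \<zeta>/(2\<alpha>)) R\<close>;
  note that \<open>exp(\<zeta>t/2) / N = exp(-\<zeta>r/2)\<close> for \<open>t = R - r\<close>.

  With \<open>r' = R - t'\<close> the radius of the second vertex, \<open>exp(\<zeta>(d - r - r'))\<close> tends to \<open>sin\<^sup>2(\<theta>/2)\<close> and is
  at least \<open>sin\<^sup>2(\<theta>/2) / 4\<close>, while the density of \<open>t'\<close> tends to \<open>\<alpha> exp(-\<alpha>t')\<close>. Dominated convergence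
  therefore gives the limit of \<open>exp(\<beta>\<zeta>r/2) q(r)\<close> as the product of the integral of
  \<open>\<alpha> exp(-(\<alpha> - \<beta>\<zeta>/2)t')\<close> over \<open>t' \<ge> 0\<close>, finite because \<open>\<beta>\<zeta> < 2\<alpha>\<close>, and the mean of
  \<open>sin(\<theta>/2) powr (-\<beta>)\<close> over the circle, a Beta integral, finite because \<open>\<beta> < 1\<close>.\<close>

section \<open>Binomial tails\<close>

text \<open>Condition on one trial: a success leaves \<open>k\<close> to be reached in the other
  \<open>n\<close> trials, a failure leaves \<open>Suc k\<close>.\<close>

lemma prob_binomial_pmf_Suc_atLeast_Suc:
  assumes "p \<in> {0..1}"
  shows "measure_pmf.prob (binomial_pmf (Suc n) p) {Suc k..} =
    p * measure_pmf.prob (binomial_pmf n p) {k..} + (1 - p) * measure_pmf.prob (binomial_pmf n p)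
        {Suc k..}"
proof -
  have *: "(\<lambda>j. if b then Suc j else j) -` {Suc k..} = (if b then {k..} else {Suc k..})" for b
    by auto
  have vimage_Suc: "Suc -` {Suc k..} = {k..}" by auto
  have "binomial_pmf (Suc n) p =
      bernoulli_pmf p \<bind> (\<lambda>b. map_pmf (\<lambda>j. if b then Suc j else j) (binomial_pmf n p))"
    unfolding binomial_pmf_Suc[OF assms] map_pmf_def
    by (intro bind_pmf_cong refl) auto
  then have "ennreal (measure_pmf.prob (binomial_pmf (Suc n) p) {Suc k..}) =
      ennreal (p * measure_pmf.prob (binomial_pmf n p) {k..} + (1 - p) * measure_pmf.prob
          (binomial_pmf n p) {Suc k..})"
    using assms
    by (simp flip: measure_pmf.emeasure_eq_measure)
       (simp add: * vimage_Suc measure_pmf.emeasure_eq_measure nn_integral_bernoulli_pmf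
           ennreal_mult ennreal_plus mult.commute)
  then show ?thesis
    using assms by (subst (asm) ennreal_inj) auto
qed

text \<open>By the recursion in the number of trials, the tail mixes the tails at \<open>j\<close>
  and at \<open>Suc j\<close> with weights \<open>p\<close> and \<open>1 - p\<close>. The induction
  hypothesis replaces both by the tails for \<open>q\<close>; moving weight towards the larger one,
  at \<open>j\<close>, can then only increase the mixture.\<close>

lemma prob_binomial_pmf_atLeast_mono:
  assumes "0 \<le> p" "p \<le> q" "q \<le> 1"
  shows "measure_pmf.prob (binomial_pmf n p) {k..} \<le> measure_pmf.prob (binomial_pmf n q) {k..}"
proof (induction n arbitrary: k)
  case 0
  then show ?case using assms by (simp add: binomial_pmf_0)
next
  case (Suc n)
  let ?T = "\<lambda>p k. measure_pmf.prob (binomial_pmf n p) {k..}"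
  show ?case
  proof (cases k)
    case 0
    then show ?thesis by (simp add: atLeast_0)
  next
    case (Suc j)
    have "p * ?T p j + (1 - p) * ?T p (Suc j) \<le> p * ?T q j + (1 - p) * ?T q (Suc j)"
      using assms Suc.IH by (intro add_mono mult_left_mono) auto
    also have "\<dots> = ?T q (Suc j) + p * (?T q j - ?T q (Suc j))"
      by (simp add: algebra_simps)
    also have "\<dots> \<le> ?T q (Suc j) + q * (?T q j - ?T q (Suc j))"
      using assms
      by (intro add_left_mono mult_right_mono) (auto intro!: measure_pmf.finite_measure_mono)
    also have "\<dots> = q * ?T q j + (1 - q) * ?T q (Suc j)"
      by (simp add: algebra_simps)
    finally show ?thesis
      using assms by (simp add: Suc prob_binomial_pmf_Suc_atLeast_Suc)
  qed
qed

text \<open>Truncation to the unit interval is itself monotone, so the comparison covers parameters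
  \<open>(1 - \<epsilon>) * p\<close> and \<open>(1 + \<epsilon>) * p\<close> that leave it.\<close>

lemma prob_Bin_atLeast_mono:
  "p \<le> q \<Longrightarrow> measure_pmf.prob (Bin n p) {k..} \<le> measure_pmf.prob (Bin n q) {k..}"
  unfolding Bin_def by (rule prob_binomial_pmf_atLeast_mono) auto

text \<open>Summing over the set of successful trials instead of their number matches the sum over
  possible neighbourhoods of \<open>u\<close>. It also shows the tail to be a polynomial in
  \<open>p\<close>, which gives measurability later.\<close>

lemma prob_binomial_pmf_atLeast_eq_sum_Pow:
  assumes "finite V" "p \<in> {0..1}"
  shows "measure_pmf.prob (binomial_pmf (card V) p) {k..} =
    (\<Sum>S | S \<subseteq> V \<and> k \<le> card S. p ^ card S * (1 - p) ^ (card V - card S))"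
proof -
  let ?f = "\<lambda>j. p ^ j * (1 - p) ^ (card V - j)"
  have "measure_pmf.prob (binomial_pmf (card V) p) {k..} =
      measure_pmf.prob (binomial_pmf (card V) p) {k..card V}"
    using assms(2) by (intro measure_pmf.finite_measure_eq_AE) (auto simp: AE_measure_pmf_iff
        set_pmf_binomial_eq split: if_splits)
  also have "\<dots> = (\<Sum>j\<in>{k..card V}. real (card {S \<in> {S. S \<subseteq> V \<and> k \<le> card S}. card S = j}) * ?f j)"
  proof (subst measure_measure_pmf_finite, simp, intro sum.cong refl)
    fix j assume "j \<in> {k..card V}"
    then have "{S \<in> {S. S \<subseteq> V \<and> k \<le> card S}. card S = j} = {S. S \<subseteq> V \<and> card S = j}"
      by auto
    then show "pmf (binomial_pmf (card V) p) j = real (card {S \<in> {S. S \<subseteq> V \<and> k \<le> card S}. card S =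
        j}) * ?f j"
      using assms by (simp add: n_subsets)
  qed
  also have "\<dots> = (\<Sum>j\<in>{k..card V}. \<Sum>S\<in>{S \<in> {S. S \<subseteq> V \<and> k \<le> card S}. card S = j}. ?f (card S))"
    by (intro sum.cong refl) simp
  also have "\<dots> = (\<Sum>S | S \<subseteq> V \<and> k \<le> card S. ?f (card S))"
    using assms by (intro sum.group) (auto intro: card_mono)
  finally show ?thesis .
qed

section \<open>The degree given the type\<close>

lemma conn_prob_bounds: "0 \<le> conn_prob N \<zeta> \<beta> x y" "conn_prob N \<zeta> \<beta> x y \<le> 1"
  unfolding conn_prob_def by (auto simp: add_pos_pos intro: add_nonneg_nonneg)

lemma conn_prob_commute: "conn_prob N \<zeta> \<beta> x y = conn_prob N \<zeta> \<beta> y x"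
  unfolding conn_prob_def hyp_dist_def rel_angle_def by (simp add: mult_ac abs_minus_commute)

text \<open>Fixing the neighbourhood of \<open>u\<close> prescribes the bit of each pair through
  \<open>u\<close> and leaves all other bits free. Under the product law this is a rectangle, so its
  probability is a product. A set \<open>S\<close> containing \<open>u\<close> or a non-vertex never
  occurs.\<close>

lemma prob_edges_given_neighbours:
  assumes "u < N"
  shows "measure_pmf.prob (edges_given N \<zeta> \<beta> x) {E. {v. v < N \<and> u \<noteq> v \<and> E (min u v, max u v)} = S} =
    (if S \<subseteq> {..<N} - {u} then
      (\<Prod>v\<in>{..<N} - {u}. if v \<in> S then conn_prob N \<zeta> \<beta> (x u) (x v) else 1 - conn_prob N \<zeta> \<beta> (x u)
          (x v))
     else 0)"
proof (cases "S \<subseteq> {..<N} - {u}")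
  case True
  define V where "V = {..<N} - {u}"
  define f where "f = (\<lambda>v. (min u v, max u v))"
  \<comment> \<open>\<open>B e\<close> is the set of admissible values of the bit at
    \<open>e\<close>: one value if \<open>e\<close> joins \<open>u\<close> to some \<open>v\<close>,
    both values otherwise.\<close>
  define B where "B = (\<lambda>e. {b. \<forall>v\<in>V. e = f v \<longrightarrow> (b \<longleftrightarrow> v \<in> S)})"
  define c where "c = (\<lambda>e. case e of (i, j) \<Rightarrow> conn_prob N \<zeta> \<beta> (x i) (x j))"
  have inj: "inj_on f V"
    by (auto simp: inj_on_def V_def f_def min_def max_def split: if_splits)
  have sub: "f ` V \<subseteq> vertex_pairs N"
    using assms by (auto simp: V_def f_def vertex_pairs_def min_def max_def)
  \<comment> \<open>Here \<open>{v \<in> S}\<close> is the singleton of the truth value of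
    \<open>v \<in> S\<close>. Injectivity of \<open>f\<close> ensures that only one condition bears
    on the pair \<open>f v\<close>.\<close>
  have Bf: "B (f v) = {v \<in> S}" if "v \<in> V" for v
    using inj that unfolding B_def by (auto simp: inj_on_def)
  have BU: "B e = UNIV" if "e \<notin> f ` V" for e
    using that unfolding B_def by auto
  have cf: "c (f v) = conn_prob N \<zeta> \<beta> (x u) (x v)" for v
    by (auto simp: c_def f_def min_def max_def conn_prob_commute)
  have "{E. {v. v < N \<and> u \<noteq> v \<and> E (min u v, max u v)} = S} = Pi (vertex_pairs N) B"
  proof (intro set_eqI iffI; clarsimp)
    fix E e assume "S = {v. v < N \<and> u \<noteq> v \<and> E (min u v, max u v)}"
    then show "E e \<in> B e" unfolding B_def V_def f_def by auto
  next
    fix E assume "E \<in> Pi (vertex_pairs N) B"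
    then have "E (f v) \<longleftrightarrow> v \<in> S" if "v \<in> V" for v
      using Bf[OF that] sub that by (auto simp: Pi_iff)
    then show "{v. v < N \<and> u \<noteq> v \<and> E (min u v, max u v)} = S"
      using True by (auto simp: V_def f_def)
  qed
  then have "measure_pmf.prob (edges_given N \<zeta> \<beta> x) {E. {v. v < N \<and> u \<noteq> v \<and> E (min u v, max u v)}
      = S} =
      (\<Prod>e\<in>vertex_pairs N. measure_pmf.prob (bernoulli_pmf (c e)) (B e))"
    unfolding edges_given_def c_def
    by (simp add: measure_Pi_pmf_Pi finite_vertex_pairs case_prod_unfold)
  \<comment> \<open>Pairs that avoid \<open>u\<close> contribute the probability of
    \<open>UNIV\<close>, a factor 1.\<close>
  also have "\<dots> = (\<Prod>e\<in>f ` V. measure_pmf.prob (bernoulli_pmf (c e)) (B e))"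
    using sub by (intro prod.mono_neutral_right finite_vertex_pairs) (auto simp: BU)
  also have "\<dots> = (\<Prod>v\<in>V. measure_pmf.prob (bernoulli_pmf (c (f v))) {v \<in> S})"
    using inj by (subst prod.reindex) (auto simp: Bf intro!: prod.cong)
  also have "\<dots> = (\<Prod>v\<in>V. if v \<in> S then conn_prob N \<zeta> \<beta> (x u) (x v) else 1 - conn_prob N \<zeta> \<beta> (x u)
      (x v))"
    by (intro prod.cong refl) (auto simp: cf measure_pmf_single conn_prob_bounds)
  finally show ?thesis using True by (simp add: V_def)
next
  case False
  then have "{E. {v. v < N \<and> u \<noteq> v \<and> E (min u v, max u v)} = S} = {}" by auto
  with False show ?thesis by simp
qed

text \<open>The event splits into the disjoint events that the neighbourhood is \<open>S\<close>.
  The component \<open>y\<close> is arbitrary because the degree reads the edge bits only.\<close>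

lemma prob_edges_given_degree:
  assumes "u < N"
  shows "measure_pmf.prob (edges_given N \<zeta> \<beta> x) {E. k \<le> vertex_degree N u (y, E)} =
    (\<Sum>S | S \<subseteq> {..<N} - {u} \<and> k \<le> card S. \<Prod>v\<in>{..<N} - {u}.
      if v \<in> S then conn_prob N \<zeta> \<beta> (x u) (x v) else 1 - conn_prob N \<zeta> \<beta> (x u) (x v))"
proof -
  let ?nb = "\<lambda>E. {v. v < N \<and> u \<noteq> v \<and> E (min u v, max u v)}"
  let ?\<S> = "{S. S \<subseteq> {..<N} - {u} \<and> k \<le> card S}"
  have "{E. k \<le> vertex_degree N u (y, E)} = (\<Union>S\<in>?\<S>. {E. ?nb E = S})"
    by (auto simp: vertex_degree_def adjacent_def)
  then have "measure_pmf.prob (edges_given N \<zeta> \<beta> x) {E. k \<le> vertex_degree N u (y, E)} =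
      (\<Sum>S\<in>?\<S>. measure_pmf.prob (edges_given N \<zeta> \<beta> x) {E. ?nb E = S})"
    by (simp, intro measure_pmf.finite_measure_finite_Union) (auto simp: disjoint_family_on_def)
  then show ?thesis using assms by (simp add: prob_edges_given_neighbours)
qed

section \<open>Rotation invariance and the probability of a single link\<close>

text \<open>An integral over a full period is invariant under shifts. The proof reduces
  \<open>\<phi>\<close> modulo \<open>2 * pi\<close>, substitutes, and moves the piece that falls
  below 0 up by one period.\<close>

lemma nn_integral_cos_shift:
  fixes g :: "real \<Rightarrow> ennreal"
  assumes [measurable]: "g \<in> borel_measurable borel"
  shows "(\<integral>\<^sup>+\<theta>. g (cos (\<phi> - \<theta>)) * indicator {0<..2 * pi} \<theta> \<partial>lborel) =
    (\<integral>\<^sup>+\<theta>. g (cos \<theta>) * indicator {0<..2 * pi} \<theta> \<partial>lborel)"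
proof -
  define k where "k = \<lfloor>\<phi> / (2 * pi)\<rfloor>"
  define \<psi> where "\<psi> = \<phi> - 2 * pi * k"
  have "real_of_int k \<le> \<phi> / (2 * pi)" "\<phi> / (2 * pi) < real_of_int k + 1"
    unfolding k_def by linarith+
  then have \<psi>: "0 \<le> \<psi>" "\<psi> < 2 * pi"
    by (simp_all add: \<psi>_def field_simps)
  have cos_eq: "cos (\<phi> - \<theta>) = cos (\<theta> - \<psi>)" for \<theta>
  proof -
    have "\<phi> - \<theta> = 2 * pi * k - (\<theta> - \<psi>)" by (simp add: \<psi>_def)
    then show ?thesis by (simp only: cos_diff[of "2 * pi * k"] cos_int_2pin sin_int_2pin)
  qed
  let ?h = "\<lambda>\<theta>. g (cos \<theta>)"
  have "(\<integral>\<^sup>+\<theta>. g (cos (\<phi> - \<theta>)) * indicator {0<..2 * pi} \<theta> \<partial>lborel) =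
      (\<integral>\<^sup>+\<theta>. g (cos (\<theta> - \<psi>)) * indicator {0<..2 * pi} \<theta> \<partial>lborel)"
    by (simp add: cos_eq)
  also have "\<dots> = (\<integral>\<^sup>+\<theta>. ?h \<theta> * indicator {0<..2 * pi} (\<psi> + \<theta>) \<partial>lborel)"
    by (subst nn_integral_real_affine[where c = 1 and t = \<psi>]) auto
  also have "\<dots> = (\<integral>\<^sup>+\<theta>. ?h \<theta> * indicator {-\<psi><..0} \<theta> + ?h \<theta> * indicator {0<..2 * pi - \<psi>} \<theta> \<partial>lborel)"
    using \<psi> by (intro nn_integral_cong) (auto split: split_indicator)
  also have "\<dots> = (\<integral>\<^sup>+\<theta>. ?h \<theta> * indicator {-\<psi><..0} \<theta> \<partial>lborel) +
      (\<integral>\<^sup>+\<theta>. ?h \<theta> * indicator {0<..2 * pi - \<psi>} \<theta> \<partial>lborel)"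
    by (intro nn_integral_add) auto
  also have "(\<integral>\<^sup>+\<theta>. ?h \<theta> * indicator {-\<psi><..0} \<theta> \<partial>lborel) =
      (\<integral>\<^sup>+\<theta>. ?h \<theta> * indicator {2 * pi - \<psi><..2 * pi} \<theta> \<partial>lborel)"
    by (subst nn_integral_real_affine[where c = 1 and t = "- 2 * pi"])
       (auto intro!: nn_integral_cong simp: cos_diff split: split_indicator)
  also have "(\<integral>\<^sup>+\<theta>. ?h \<theta> * indicator {2 * pi - \<psi><..2 * pi} \<theta> \<partial>lborel) +
      (\<integral>\<^sup>+\<theta>. ?h \<theta> * indicator {0<..2 * pi - \<psi>} \<theta> \<partial>lborel) =
      (\<integral>\<^sup>+\<theta>. ?h \<theta> * indicator {2 * pi - \<psi><..2 * pi} \<theta> + ?h \<theta> * indicator {0<..2 * pi - \<psi>} \<theta> \<partial>lborel)"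
    by (intro nn_integral_add[symmetric]) auto
  also have "\<dots> = (\<integral>\<^sup>+\<theta>. ?h \<theta> * indicator {0<..2 * pi} \<theta> \<partial>lborel)"
    using \<psi> by (intro nn_integral_cong) (auto split: split_indicator)
  finally show ?thesis .
qed

lemma borel_measurable_conn_prob [measurable]:
  "case_prod (conn_prob N \<zeta> \<beta>) \<in> borel_measurable ((borel \<Otimes>\<^sub>M borel) \<Otimes>\<^sub>M (borel \<Otimes>\<^sub>M borel))"
  unfolding conn_prob_def hyp_dist_def cos_rel_angle arcosh_def sinh_field_def cosh_field_def
      case_prod_unfold
  by measurable

lemma borel_measurable_radius_density [measurable]:
  "radius_density N \<zeta> \<alpha> \<in> borel_measurable borel"
  unfolding radius_density_def sinh_field_def by measurable

lemma nn_integral_vertex_law: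
  assumes [measurable]: "f \<in> borel_measurable (borel \<Otimes>\<^sub>M borel)"
  shows "(\<integral>\<^sup>+z. f z \<partial>vertex_law N \<zeta> \<alpha>) =
    (\<integral>\<^sup>+r. ennreal (radius_density N \<zeta> \<alpha> r) *
       ((\<integral>\<^sup>+\<theta>. f (r, \<theta>) * indicator {0<..2 * pi} \<theta> \<partial>lborel) / ennreal (2 * pi)) \<partial>lborel)"
proof -
  interpret B: prob_space "uniform_measure lborel {0<..2 * pi}"
    by (intro prob_space_uniform_measure) auto
  have "(\<integral>\<^sup>+z. f z \<partial>vertex_law N \<zeta> \<alpha>) =
      (\<integral>\<^sup>+r. \<integral>\<^sup>+\<theta>. f (r, \<theta>) \<partial>uniform_measure lborel {0<..2 * pi}
        \<partial>density lborel (\<lambda>r. ennreal (radius_density N \<zeta> \<alpha> r)))"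
    unfolding vertex_law_def
    by (intro B.nn_integral_fst[symmetric]) (simp cong: measurable_cong_sets sets_pair_measure_cong)
  also have "\<dots> = (\<integral>\<^sup>+r. ennreal (radius_density N \<zeta> \<alpha> r) *
      (\<integral>\<^sup>+\<theta>. f (r, \<theta>) \<partial>uniform_measure lborel {0<..2 * pi}) \<partial>lborel)"
    by (subst nn_integral_density) (auto cong: measurable_cong_sets sets_pair_measure_cong)
  also have "\<dots> = (\<integral>\<^sup>+r. ennreal (radius_density N \<zeta> \<alpha> r) *
       ((\<integral>\<^sup>+\<theta>. f (r, \<theta>) * indicator {0<..2 * pi} \<theta> \<partial>lborel) / ennreal (2 * pi)) \<partial>lborel)"
    by (subst nn_integral_uniform_measure) auto
  finally show ?thesis .
qed

lemma prob_space_vertex_law: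
  assumes "0 < \<zeta>" "0 < \<alpha>" "1 < N"
  shows "prob_space (vertex_law N \<zeta> \<alpha>)"
proof -
  interpret A: prob_space "density lborel (\<lambda>r. ennreal (radius_density N \<zeta> \<alpha> r))"
    by (rule prob_space_radius[OF assms])
  interpret B: prob_space "uniform_measure lborel {0<..2 * pi}"
    by (intro prob_space_uniform_measure) auto
  interpret pair_prob_space "density lborel (\<lambda>r. ennreal (radius_density N \<zeta> \<alpha> r))"
    "uniform_measure lborel {0<..2 * pi}" ..
  show ?thesis unfolding vertex_law_def by (rule prob_space_axioms)
qed

text \<open>By rotation invariance the angle of the first vertex is irrelevant.\<close>

definition link_prob :: "nat \<Rightarrow> real \<Rightarrow> real \<Rightarrow> real \<Rightarrow> real \<Rightarrow> real" where
  "link_prob N \<zeta> \<alpha> \<beta> r = (\<integral>z. conn_prob N \<zeta> \<beta> (r, 0) z \<partial>vertex_law N \<zeta> \<alpha>)"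

lemma measurable_vertex_law_eq: "measurable (vertex_law N \<zeta> \<alpha>) M = measurable (borel \<Otimes>\<^sub>M borel) M"
  by (rule measurable_cong_sets[OF sets_vertex_law refl])

text \<open>The angle of \<open>y\<close> enters only through the cosine of the angular difference,
  so averaging over the uniform angle of the other vertex removes it.\<close>

lemma nn_integral_conn_prob:
  assumes "0 < \<zeta>" "0 < \<alpha>" "1 < N"
  shows "(\<integral>\<^sup>+z. ennreal (conn_prob N \<zeta> \<beta> y z) \<partial>vertex_law N \<zeta> \<alpha>) =
      ennreal (link_prob N \<zeta> \<alpha> \<beta> (fst y))"
proof -
  interpret V: prob_space "vertex_law N \<zeta> \<alpha>" by (rule prob_space_vertex_law[OF assms])
  \<comment> \<open>\<open>g\<close> is the connection probability as a function of the two radii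
    and that cosine, the shape required by \<open>nn_integral_cos_shift\<close>.\<close>
  define g where "g = (\<lambda>r r' c. ennreal (1 / (exp (\<beta> * (\<zeta> / 2) * (arcosh (cosh (\<zeta> * r) * cosh (\<zeta> *
      r')
       - sinh (\<zeta> * r) * sinh (\<zeta> * r') * c) / \<zeta> - disc_radius \<zeta> N)) + 1)))"
  have g [measurable]: "g r r' \<in> borel_measurable borel" for r r'
    unfolding g_def arcosh_def by measurable
  have conn: "ennreal (conn_prob N \<zeta> \<beta> (r, \<phi>) (r', \<theta>)) = g r r' (cos (\<phi> - \<theta>))" for r \<phi> r' \<theta>
    by (simp add: conn_prob_def hyp_dist_def cos_rel_angle g_def)
  have "(\<integral>\<^sup>+z. ennreal (conn_prob N \<zeta> \<beta> (r, \<phi>) z) \<partial>vertex_law N \<zeta> \<alpha>) =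
      (\<integral>\<^sup>+r'. ennreal (radius_density N \<zeta> \<alpha> r') *
       ((\<integral>\<^sup>+\<theta>. g r r' (cos \<theta>) * indicator {0<..2 * pi} \<theta> \<partial>lborel) / ennreal (2 * pi)) \<partial>lborel)" for
           r \<phi>
    by (subst nn_integral_vertex_law) (auto simp: conn nn_integral_cos_shift)
  then have "(\<integral>\<^sup>+z. ennreal (conn_prob N \<zeta> \<beta> y z) \<partial>vertex_law N \<zeta> \<alpha>) =
      (\<integral>\<^sup>+z. ennreal (conn_prob N \<zeta> \<beta> (fst y, 0) z) \<partial>vertex_law N \<zeta> \<alpha>)"
    by (cases y) simp
  also have "\<dots> = ennreal (link_prob N \<zeta> \<alpha> \<beta> (fst y))"
    unfolding link_prob_def
    by (intro nn_integral_eq_integral V.integrable_const_bound[where B = 1] AE_I2)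
       (auto simp: conn_prob_bounds measurable_vertex_law_eq)
  finally show ?thesis .
qed

lemma link_prob_bounds:
  assumes "0 < \<zeta>" "0 < \<alpha>" "1 < N"
  shows "0 \<le> link_prob N \<zeta> \<alpha> \<beta> r" "link_prob N \<zeta> \<alpha> \<beta> r \<le> 1"
proof -
  interpret V: prob_space "vertex_law N \<zeta> \<alpha>" by (rule prob_space_vertex_law[OF assms])
  show "0 \<le> link_prob N \<zeta> \<alpha> \<beta> r"
    unfolding link_prob_def by (intro integral_nonneg_AE) (auto simp: conn_prob_bounds)
  have "ennreal (link_prob N \<zeta> \<alpha> \<beta> r) \<le> (\<integral>\<^sup>+z. 1 \<partial>vertex_law N \<zeta> \<alpha>)"
    using nn_integral_conn_prob[OF assms, of \<beta> "(r, 0)"]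
    by (subst fst_conv[symmetric, of r 0], subst nn_integral_conn_prob[OF assms, symmetric])
       (intro nn_integral_mono, simp add: conn_prob_bounds)
  then show "link_prob N \<zeta> \<alpha> \<beta> r \<le> 1" by (simp add: V.emeasure_space_1)
qed

text \<open>Supplies the factor of a non-neighbour when the product over the other vertices is
  integrated.\<close>

lemma nn_integral_conn_prob_compl:
  assumes "0 < \<zeta>" "0 < \<alpha>" "1 < N"
  shows "(\<integral>\<^sup>+z. ennreal (1 - conn_prob N \<zeta> \<beta> y z) \<partial>vertex_law N \<zeta> \<alpha>) =
      ennreal (1 - link_prob N \<zeta> \<alpha> \<beta> (fst y))"
proof -
  interpret V: prob_space "vertex_law N \<zeta> \<alpha>" by (rule prob_space_vertex_law[OF assms])
  have [measurable]: "conn_prob N \<zeta> \<beta> y \<in> borel_measurable (vertex_law N \<zeta> \<alpha>)"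
    using measurable_compose_Pair1[OF _ borel_measurable_conn_prob, of y]
    by (simp add: measurable_vertex_law_eq space_pair_measure)
  have "(\<integral>\<^sup>+z. ennreal (1 - conn_prob N \<zeta> \<beta> y z) \<partial>vertex_law N \<zeta> \<alpha>) =
      (\<integral>\<^sup>+z. 1 - ennreal (conn_prob N \<zeta> \<beta> y z) \<partial>vertex_law N \<zeta> \<alpha>)"
    by (intro nn_integral_cong) (simp add: conn_prob_bounds ennreal_minus flip: ennreal_1)
  also have "\<dots> = 1 - ennreal (link_prob N \<zeta> \<alpha> \<beta> (fst y))"
    by (subst nn_integral_diff)
       (auto simp: conn_prob_bounds nn_integral_conn_prob[OF assms] V.emeasure_space_1)
  finally show ?thesis
    by (simp add: link_prob_bounds[OF assms] ennreal_minus flip: ennreal_1)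
qed

section \<open>Integration over the random graph and the conditional law of the degree\<close>

lemma nn_integral_hyp_graph:
  assumes f: "f \<in> borel_measurable (positions N \<zeta> \<alpha> \<Otimes>\<^sub>M count_space UNIV)"
  shows "(\<integral>\<^sup>+G. f G \<partial>hyp_graph N \<zeta> \<alpha> \<beta>) =
    (\<integral>\<^sup>+x. \<integral>\<^sup>+E. f (x, E) \<partial>edges_given N \<zeta> \<beta> x \<partial>positions N \<zeta> \<alpha>)"
proof -
  have "(\<integral>\<^sup>+G. f G \<partial>hyp_graph N \<zeta> \<alpha> \<beta>) =
    (\<integral>\<^sup>+x. \<integral>\<^sup>+G. f G \<partial>distr (measure_pmf (edges_given N \<zeta> \<beta> x))
              (positions N \<zeta> \<alpha> \<Otimes>\<^sub>M count_space UNIV) (\<lambda>E. (x, E)) \<partial>positions N \<zeta> \<alpha>)"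
    unfolding hyp_graph_def
    by (rule nn_integral_bind[OF f measurable_prob_algebraD[OF edges_kernel_measurable]])
  also have "\<dots> = (\<integral>\<^sup>+x. \<integral>\<^sup>+E. f (x, E) \<partial>edges_given N \<zeta> \<beta> x \<partial>positions N \<zeta> \<alpha>)"
    using f by (intro nn_integral_cong nn_integral_distr) (auto simp: space_pair_measure)
  finally show ?thesis .
qed

lemma sets_hyp_graph:
  assumes "0 < \<zeta>" "0 < \<alpha>" "1 < N"
  shows "sets (hyp_graph N \<zeta> \<alpha> \<beta>) = sets (positions N \<zeta> \<alpha> \<Otimes>\<^sub>M count_space UNIV)"
  unfolding hyp_graph_def
  using prob_space.not_empty[OF prob_space_positions[OF assms]] by (intro sets_bind) auto

text \<open>Fubini for the product law, with \<open>u\<close> in the outer integral so that its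
  position is fixed while the others are averaged.\<close>

lemma nn_integral_positions:
  assumes "0 < \<zeta>" "0 < \<alpha>" "1 < N" "u < N"
    and f: "f \<in> borel_measurable (positions N \<zeta> \<alpha>)"
  shows "(\<integral>\<^sup>+x. f x \<partial>positions N \<zeta> \<alpha>) =
    (\<integral>\<^sup>+y. \<integral>\<^sup>+x. f (x(u := y)) \<partial>(\<Pi>\<^sub>M v\<in>{..<N} - {u}. vertex_law N \<zeta> \<alpha>) \<partial>vertex_law N \<zeta> \<alpha>)"
proof -
  interpret V: prob_space "vertex_law N \<zeta> \<alpha>" by (rule prob_space_vertex_law[OF assms(1-3)])
  interpret P: product_sigma_finite "\<lambda>_. vertex_law N \<zeta> \<alpha>" by standard
  have ins: "{..<N} = insert u ({..<N} - {u})" using assms(4) by auto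
  show ?thesis
    using f assms(4) unfolding positions_def
    by (subst ins, intro P.product_nn_integral_insert_rev) (auto simp: insert_absorb)
qed

lemma measurable_position:
  assumes "u < N"
  shows "(\<lambda>x. x u) \<in> positions N \<zeta> \<alpha> \<rightarrow>\<^sub>M borel \<Otimes>\<^sub>M borel"
  using measurable_component_singleton[of u "{..<N}" "\<lambda>_. vertex_law N \<zeta> \<alpha>"] assms
    measurable_cong_sets[OF refl sets_vertex_law]
  unfolding positions_def by blast

lemma borel_measurable_link_prob [measurable]:
  assumes "0 < \<zeta>" "0 < \<alpha>" "1 < N"
  shows "link_prob N \<zeta> \<alpha> \<beta> \<in> borel_measurable borel"
proof -
  interpret V: prob_space "vertex_law N \<zeta> \<alpha>" by (rule prob_space_vertex_law[OF assms])
  have [measurable_cong]: "sets (vertex_law N \<zeta> \<alpha>) = sets (borel \<Otimes>\<^sub>M borel)"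
      by (rule sets_vertex_law)
  have "(\<lambda>(r, z). conn_prob N \<zeta> \<beta> (r, 0) z) \<in> borel_measurable (borel \<Otimes>\<^sub>M vertex_law N \<zeta> \<alpha>)"
    by measurable
  from V.borel_measurable_lebesgue_integral[OF this]
  show ?thesis unfolding link_prob_def .
qed

text \<open>Serves to return from the position of \<open>u\<close> to the graph once the integrand
  depends on the type alone.\<close>

lemma nn_integral_vertex_type:
  assumes "0 < \<zeta>" "0 < \<alpha>" "1 < N" "u < N" and [measurable]: "f \<in> borel_measurable borel"
  shows "(\<integral>\<^sup>+G. f (vertex_type N \<zeta> u G) \<partial>hyp_graph N \<zeta> \<alpha> \<beta>) =
    (\<integral>\<^sup>+y. f (disc_radius \<zeta> N - fst y) \<partial>vertex_law N \<zeta> \<alpha>)"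
proof -
  interpret V: prob_space "vertex_law N \<zeta> \<alpha>" by (rule prob_space_vertex_law[OF assms(1-3)])
  interpret P: prob_space "\<Pi>\<^sub>M v\<in>{..<N} - {u}. vertex_law N \<zeta> \<alpha>"
    by (intro prob_space_PiM V.prob_space_axioms)
  note [measurable] = measurable_position[OF assms(4)]
  show ?thesis
    unfolding vertex_type_def
    by (subst nn_integral_hyp_graph, measurable)
       (simp add: measure_pmf.emeasure_space_1 nn_integral_positions[OF assms(1-4)]
           P.emeasure_space_1)
qed

text \<open>This is the defining identity of the conditional probability, tested on the event that
  the type lies in \<open>A\<close>. Given the position of \<open>u\<close> the other vertices are
  independent, so averaging the term of a neighbourhood \<open>S\<close> yields
  \<open>card S\<close> factors \<open>link_prob\<close> and \<open>N - 1 - card S\<close>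
  complementary ones, which is the binomial weight.\<close>

lemma nn_integral_type_degree:
  assumes "0 < \<zeta>" "0 < \<alpha>" "1 < N" "u < N" and [measurable]: "A \<in> sets borel"
  shows "(\<integral>\<^sup>+G. indicator A (vertex_type N \<zeta> u G) * indicator {G. k \<le>
      vertex_degree N u G} G \<partial>hyp_graph N \<zeta> \<alpha> \<beta>) =
    (\<integral>\<^sup>+G. indicator A (vertex_type N \<zeta> u G) * ennreal (measure_pmf.prob
       (binomial_pmf (N - 1) (link_prob N \<zeta> \<alpha> \<beta> (disc_radius \<zeta> N - vertex_type N \<zeta> u G))) {k..})
           \<partial>hyp_graph N \<zeta> \<alpha> \<beta>)"
proof -
  let ?R = "disc_radius \<zeta> N" and ?V = "{..<N} - {u}"
  let ?\<S> = "{S. S \<subseteq> ?V \<and> k \<le> card S}"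
  let ?q = "link_prob N \<zeta> \<alpha> \<beta>"
  let ?c = "\<lambda>S v y z. if v \<in> S then conn_prob N \<zeta> \<beta> y z else 1 - conn_prob N \<zeta> \<beta> y z"
  let ?T = "\<lambda>p. \<Sum>S\<in>?\<S>. p ^ card S * (1 - p) ^ (N - 1 - card S)"
  interpret V: prob_space "vertex_law N \<zeta> \<alpha>" by (rule prob_space_vertex_law[OF assms(1-3)])
  interpret P: product_sigma_finite "\<lambda>_. vertex_law N \<zeta> \<alpha>" by standard
  have pos [measurable]: "(\<lambda>x. x v) \<in> positions N \<zeta> \<alpha> \<rightarrow>\<^sub>M borel \<Otimes>\<^sub>M borel" if "v < N" for v
    using that by (rule measurable_position)
  have cmeas: "(\<lambda>x. conn_prob N \<zeta> \<beta> (x u) (x v)) \<in> borel_measurable (positions N \<zeta> \<alpha>)"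
      if "v < N" for v
    using that assms(4) by (rule conn_prob_measurable[rotated])
  have [measurable]: "conn_prob N \<zeta> \<beta> y \<in> borel_measurable (vertex_law N \<zeta> \<alpha>)" for y
    using measurable_compose_Pair1[OF _ borel_measurable_conn_prob, of y]
    by (simp add: measurable_vertex_law_eq space_pair_measure)
  have [measurable]: "?q \<in> borel_measurable borel"
    by (rule borel_measurable_link_prob[OF assms(1-3)])
  have cardV: "card ?V = N - 1" using assms(4) by simp
  have tail: "measure_pmf.prob (binomial_pmf (N - 1) (?q r)) {k..} = ?T (?q r)" for r
    using prob_binomial_pmf_atLeast_eq_sum_Pow[of ?V "?q r" k] link_prob_bounds[OF assms(1-3)]
    by (simp add: cardV)
  have c_nonneg: "0 \<le> ?c S v y z" for S v y z
    by (simp add: conn_prob_bounds)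
  have q_nonneg: "0 \<le> (if v \<in> S then ?q r else 1 - ?q r)" for S r and v :: nat
    using link_prob_bounds[OF assms(1-3)] by simp

  \<comment> \<open>First the edges are averaged with all positions fixed; the type is constant in
    this integral.\<close>
  have kernel: "(\<integral>\<^sup>+E. indicator A (vertex_type N \<zeta> u (x, E)) * indicator {G. k \<le>
      vertex_degree N u G} (x, E) \<partial>edges_given N \<zeta> \<beta> x) =
      indicator A (?R - fst (x u)) * ennreal (\<Sum>S\<in>?\<S>. \<Prod>v\<in>?V. ?c S v (x u) (x v))" for x
  proof -
    have "(\<integral>\<^sup>+E. indicator A (vertex_type N \<zeta> u (x, E)) * indicator {G. k \<le>
        vertex_degree N u G} (x, E) \<partial>edges_given N \<zeta> \<beta> x) =
        (\<integral>\<^sup>+E. indicator A (?R - fst (x u)) * indicator {E. k \<le>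
            vertex_degree N u (x, E)} E \<partial>edges_given N \<zeta> \<beta> x)"
      by (simp add: vertex_type_def indicator_def)
    also have "\<dots> = indicator A (?R - fst (x u)) * emeasure (edges_given N \<zeta> \<beta> x) {E. k \<le>
        vertex_degree N u (x, E)}"
      by (subst nn_integral_cmult) auto
    finally show ?thesis
      by (simp only: measure_pmf.emeasure_eq_measure prob_edges_given_degree[OF assms(4)])
  qed
  \<comment> \<open>Then the other positions are averaged, with \<open>y\<close> the position of
    \<open>u\<close>. Each term of the finite sum is a product of functions of different
    coordinates, so its integral factorises.\<close>
  have fubini: "(\<integral>\<^sup>+x. indicator A (?R - fst y) * ennreal (\<Sum>S\<in>?\<S>. \<Prod>v\<in>?V. ?c S v y (x v)) \<partial>(\<Pi>\<^sub>M v\<in>?V.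
      vertex_law N \<zeta> \<alpha>)) =
      indicator A (?R - fst y) * ennreal (?T (?q (fst y)))" for y
  proof -
    have "(\<integral>\<^sup>+x. ennreal (\<Sum>S\<in>?\<S>. \<Prod>v\<in>?V. ?c S v y (x v)) \<partial>(\<Pi>\<^sub>M v\<in>?V. vertex_law N \<zeta> \<alpha>)) =
        (\<integral>\<^sup>+x. (\<Sum>S\<in>?\<S>. \<Prod>v\<in>?V. ennreal (?c S v y (x v))) \<partial>(\<Pi>\<^sub>M v\<in>?V. vertex_law N \<zeta> \<alpha>))"
      by (intro nn_integral_cong) (simp add: sum_ennreal[symmetric] prod_ennreal[symmetric]
          prod_nonneg c_nonneg del: sum_ennreal)
    also have "\<dots> = (\<Sum>S\<in>?\<S>. \<integral>\<^sup>+x. (\<Prod>v\<in>?V. ennreal (?c S v y (x v))) \<partial>(\<Pi>\<^sub>M v\<in>?V. vertex_law N \<zeta> \<alpha>))"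
      by (intro nn_integral_sum) measurable
    also have "\<dots> = (\<Sum>S\<in>?\<S>. \<Prod>v\<in>?V. \<integral>\<^sup>+z. ennreal (?c S v y z) \<partial>vertex_law N \<zeta> \<alpha>)"
      by (intro sum.cong refl P.product_nn_integral_prod) auto
    also have "\<dots> = (\<Sum>S\<in>?\<S>. \<Prod>v\<in>?V. ennreal (if v \<in> S then ?q (fst y) else 1 - ?q (fst y)))"
      by (intro sum.cong prod.cong refl)
         (simp add: nn_integral_conn_prob[OF assms(1-3)] nn_integral_conn_prob_compl[OF assms(1-3)])
    also have "\<dots> = ennreal (\<Sum>S\<in>?\<S>. \<Prod>v\<in>?V. (if v \<in> S then ?q (fst y) else 1 - ?q (fst y)))"
      by (subst sum_ennreal[symmetric])
         (auto intro!: sum.cong prod_nonneg simp: prod_ennreal[symmetric] q_nonneg)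
    also have "\<dots> = ennreal (?T (?q (fst y)))"
    proof (intro arg_cong[where f = ennreal] sum.cong refl)
      fix S assume "S \<in> ?\<S>"
      then have "?V \<inter> {v. v \<in> S} = S" "?V \<inter> - {v. v \<in> S} = ?V - S" "card (?V - S) = N - 1 - card S"
        using cardV by (auto simp: card_Diff_subset finite_subset[of S ?V])
      then show "(\<Prod>v\<in>?V. if v \<in> S then ?q (fst y) else 1 - ?q (fst y)) =
          ?q (fst y) ^ card S * (1 - ?q (fst y)) ^ (N - 1 - card S)"
        by (subst prod.If_cases) auto
    qed
    finally show ?thesis
      by (subst nn_integral_cmult) (auto intro!: borel_measurable_sum borel_measurable_prod)
  qed
  have "(\<integral>\<^sup>+G. indicator A (vertex_type N \<zeta> u G) * indicator {G. k \<le>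
      vertex_degree N u G} G \<partial>hyp_graph N \<zeta> \<alpha> \<beta>) =
      (\<integral>\<^sup>+x. indicator A (?R - fst (x u)) * ennreal (\<Sum>S\<in>?\<S>. \<Prod>v\<in>?V. ?c S v (x u) (x v)) \<partial>positions N
          \<zeta> \<alpha>)"
  proof (subst nn_integral_hyp_graph)
    let ?P = "positions N \<zeta> \<alpha> \<Otimes>\<^sub>M count_space UNIV"
    have D: "vertex_degree N u \<in> ?P \<rightarrow>\<^sub>M count_space UNIV"
      unfolding vertex_degree_def adjacent_def by (rule measurable_compose[OF measurable_snd]) simp
    have "(\<lambda>x. ?R - fst (x u)) \<in> borel_measurable (positions N \<zeta> \<alpha>)"
      by (intro borel_measurable_diff borel_measurable_const measurable_compose[OF pos[OF
          assms(4)] measurable_fst])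
    then have Y: "vertex_type N \<zeta> u \<in> borel_measurable ?P"
      unfolding vertex_type_def by (rule measurable_compose[OF measurable_fst])
    have ind: "(indicator {G. k \<le> vertex_degree N u G} G :: ennreal) =
        indicator {k..} (vertex_degree N u G)" for G
      by (auto simp: indicator_def)
    show "(\<lambda>G. indicator A (vertex_type N \<zeta> u G) * indicator {G. k \<le>
        vertex_degree N u G} G :: ennreal) \<in> borel_measurable ?P"
      unfolding ind
      by (intro borel_measurable_times_ennreal measurable_compose[OF Y] measurable_compose[OF D])
          auto
  qed (simp only: kernel)
  also have "\<dots> = (\<integral>\<^sup>+y. \<integral>\<^sup>+x. indicator A (?R - fst y) * ennreal (\<Sum>S\<in>?\<S>. \<Prod>v\<in>?V. ?c S v y (x v))
      \<partial>(\<Pi>\<^sub>M v\<in>?V. vertex_law N \<zeta> \<alpha>) \<partial>vertex_law N \<zeta> \<alpha>)"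
  proof (subst nn_integral_positions[OF assms(1-4)])
    show "(\<lambda>x. indicator A (?R - fst (x u)) * ennreal (\<Sum>S\<in>?\<S>. \<Prod>v\<in>?V. ?c S v (x u) (x v)))
        \<in> borel_measurable (positions N \<zeta> \<alpha>)"
      using assms(4) cmeas
      by (intro borel_measurable_times_ennreal measurable_compose[OF _ measurable_ennreal]
          borel_measurable_sum borel_measurable_prod)
         (auto intro!: borel_measurable_diff)
  qed (auto intro!: nn_integral_cong arg_cong2[where f = "(*)"] arg_cong[where f =
      ennreal] sum.cong prod.cong split: if_splits)
  \<comment> \<open>The radius is written as \<open>?R - (?R - fst y)\<close> to exhibit the
    integrand as a function of the type.\<close>
  also have "\<dots> = (\<integral>\<^sup>+y. indicator A (?R - fst y) * ennreal (?T (?q (?R - (?R - fst y))))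
      \<partial>vertex_law N \<zeta> \<alpha>)"
    by (simp only: fubini) simp
  also have "\<dots> = (\<integral>\<^sup>+G. indicator A (vertex_type N \<zeta> u G) * ennreal (?T (?q (?R - vertex_type N \<zeta> u
      G))) \<partial>hyp_graph N \<zeta> \<alpha> \<beta>)"
    by (rule nn_integral_vertex_type[OF assms(1-4), symmetric]) measurable
  finally show ?thesis by (simp only: tail)
qed

text \<open>A conditional expectation is determined almost surely by its integrals over the events
  generated by the type, and \<open>nn_integral_type_degree\<close> computes these. The null set may
  depend on \<open>k\<close>.\<close>

lemma AE_cond_tail_vertex_degree:
  assumes "0 < \<zeta>" "0 < \<alpha>" "1 < N" "u < N"
  shows "AE G in hyp_graph N \<zeta> \<alpha> \<beta>.
    cond_tail (hyp_graph N \<zeta> \<alpha> \<beta>) (vertex_type N \<zeta> u) (vertex_degree N u) G k =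
    measure_pmf.prob (Bin (N - 1) (link_prob N \<zeta> \<alpha> \<beta> (disc_radius \<zeta> N - vertex_type N \<zeta> u G)))
        {k..}"
proof -
  let ?M = "hyp_graph N \<zeta> \<alpha> \<beta>" and ?Y = "vertex_type N \<zeta> u"
  let ?F = "vimage_algebra (space ?M) ?Y borel"
  let ?q = "link_prob N \<zeta> \<alpha> \<beta>"
  define h where "h = (\<lambda>t. measure_pmf.prob (binomial_pmf (N - 1) (?q (disc_radius \<zeta> N - t)))
      {k..})"
  interpret M: prob_space ?M by (rule prob_space_hyp_graph[OF assms(1-3)])
  have [measurable_cong]: "sets ?M = sets (positions N \<zeta> \<alpha> \<Otimes>\<^sub>M count_space UNIV)"
    by (rule sets_hyp_graph[OF assms(1-3)])
  note [measurable] = measurable_position[OF assms(4)] borel_measurable_link_prob[OF assms(1-3)]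
  have Y [measurable]: "?Y \<in> borel_measurable ?M"
    unfolding vertex_type_def by measurable
  have D [measurable]: "vertex_degree N u \<in> ?M \<rightarrow>\<^sub>M count_space UNIV"
  proof -
    have "vertex_degree N u \<in> positions N \<zeta> \<alpha> \<Otimes>\<^sub>M count_space UNIV \<rightarrow>\<^sub>M count_space UNIV"
      unfolding vertex_degree_def adjacent_def by (rule measurable_compose[OF measurable_snd]) simp
    then show ?thesis by measurable
  qed
  \<comment> \<open>Measurability of the tail in the type comes from its form as a polynomial in
    \<open>link_prob\<close>.\<close>
  have h [measurable]: "h \<in> borel_measurable borel"
  proof -
    have "h = (\<lambda>t. \<Sum>S | S \<subseteq> {..<N} - {u} \<and> k \<le> card S. ?q (disc_radius \<zeta> N - t) ^ card S *
        (1 - ?q (disc_radius \<zeta> N - t)) ^ (N - 1 - card S))"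
      using prob_binomial_pmf_atLeast_eq_sum_Pow[of "{..<N} - {u}" _ k] link_prob_bounds[OF
          assms(1-3)] assms(4)
      by (simp add: h_def)
    then show ?thesis by simp
  qed
  have h_bounds: "0 \<le> h t" "h t \<le> 1" for t by (simp_all add: h_def)
  have sub: "subalgebra ?M ?F"
    using Y by (auto simp: subalgebra_def sets_vimage_algebra2 space_vimage_algebra
        measurable_space intro: measurable_sets)
  interpret F: finite_measure_subalgebra ?M ?F
    by standard (rule sub)
  let ?D = "{G \<in> space ?M. k \<le> vertex_degree N u G}"
  have "AE G in ?M. real_cond_exp ?M ?F (indicator ?D) G = h (?Y G)"
  proof (rule F.real_cond_exp_charact)
    fix A' assume "A' \<in> sets ?F"
    then obtain A where A: "A \<in> sets borel" "A' = ?Y -` A \<inter> space ?M"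
      by (auto simp: sets_vimage_algebra2)
    note [measurable] = A(1)
    have "ennreal (\<integral>G\<in>A'. indicator ?D G \<partial>?M) =
        (\<integral>\<^sup>+G. ennreal (indicator A' G *\<^sub>R indicator ?D G) \<partial>?M)"
      unfolding set_lebesgue_integral_def A(2)
      by (intro nn_integral_eq_integral[symmetric] M.integrable_const_bound[where B = 1] AE_I2)
         (auto simp: indicator_def)
    also have "\<dots> = (\<integral>\<^sup>+G. indicator A (?Y G) * indicator {G. k \<le> vertex_degree N u G} G \<partial>?M)"
      by (intro nn_integral_cong) (auto simp: A(2) indicator_def)
    also have "\<dots> = (\<integral>\<^sup>+G. indicator A (?Y G) * ennreal (h (?Y G)) \<partial>?M)"
      unfolding h_def by (rule nn_integral_type_degree[OF assms A(1)])
    also have "\<dots> = (\<integral>\<^sup>+G. ennreal (indicator A' G *\<^sub>R h (?Y G)) \<partial>?M)"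
      by (intro nn_integral_cong) (auto simp: A(2) indicator_def)
    also have "\<dots> = ennreal (\<integral>G\<in>A'. h (?Y G) \<partial>?M)"
      unfolding set_lebesgue_integral_def A(2)
      by (intro nn_integral_eq_integral M.integrable_const_bound[where B = 1] AE_I2)
         (auto simp: indicator_def h_bounds)
    finally show "(\<integral>G\<in>A'. indicator ?D G \<partial>?M) = (\<integral>G\<in>A'. h (?Y G) \<partial>?M)"
      unfolding set_lebesgue_integral_def
      by (subst (asm) ennreal_inj) (auto intro!: integral_nonneg_AE simp: h_bounds)
  next
    show "integrable ?M (indicator ?D :: _ \<Rightarrow> real)"
      by (intro M.integrable_const_bound[where B = 1] AE_I2) (auto simp: indicator_def)
    show "integrable ?M (\<lambda>G. h (?Y G))"
      by (intro M.integrable_const_bound[where B = 1] AE_I2) (auto simp: h_bounds)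
    show "(\<lambda>G. h (?Y G)) \<in> borel_measurable ?F"
      by (rule measurable_compose[OF measurable_vimage_algebra1 h]) auto
  qed
  then show ?thesis
    using link_prob_bounds[OF assms(1-3)] by (simp add: cond_tail_def h_def Bin_def)
qed

section \<open>Asymptotics of the connection probability\<close>

text \<open>The substitution \<open>y = (sin (\<theta> / 2))^2\<close> maps [0, pi] to [0, 1] with
  derivative \<open>sin (\<theta> / 2) * cos (\<theta> / 2)\<close> and turns the Beta integrand for
  \<open>(1 - \<beta>) / 2\<close> and \<open>1 / 2\<close> into
  \<open>sin (\<theta> / 2) powr (-\<beta>)\<close>. Reflection of \<theta> to
  \<open>2 * pi - \<theta>\<close> supplies the other half, hence the factor 2.\<close>

lemma nn_integral_sin_powr:
  assumes "\<beta> < 1"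
  shows "(\<integral>\<^sup>+\<theta>. ennreal (sin (\<theta> / 2) powr (-\<beta>)) * indicator {0<..<2 * pi} \<theta> \<partial>lborel) =
    ennreal (2 * Beta ((1 - \<beta>) / 2) (1 / 2))"
proof -
  let ?f = "\<lambda>y. ennreal (y powr ((1 - \<beta>) / 2 - 1) * (1 - y) powr (1 / 2 - 1))"
  let ?s = "\<lambda>\<theta>. ennreal (sin (\<theta> / 2) powr (-\<beta>))"
  have Beta_pos: "0 \<le> Beta ((1 - \<beta>) / 2) (1 / 2)"
    unfolding Beta_def using assms
    by (intro divide_nonneg_nonneg mult_nonneg_nonneg Gamma_real_nonneg) (auto simp: field_simps)
  have beta: "(\<integral>\<^sup>+y. ?f y * indicator {0..1} y \<partial>lborel) = ennreal (Beta ((1 - \<beta>) / 2) (1 / 2))"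
    using nn_integral_has_integral_lebesgue[OF _ has_integral_Beta_real, of "(1 - \<beta>) / 2" "1 / 2"]
        assms
    by (simp add: nn_integral_completion ennreal_indicator ennreal_mult'' mult.commute)
  have "(\<integral>\<^sup>+y. ?f y * indicator {(sin (0 / 2))\<^sup>2..(sin (pi / 2))\<^sup>2} y \<partial>lborel) =
      (\<integral>\<^sup>+\<theta>. ?f ((sin (\<theta> / 2))\<^sup>2) * ennreal (sin (\<theta> / 2) * cos (\<theta> / 2)) * indicator {0..pi} \<theta>
          \<partial>lborel)"
    by (intro nn_integral_substitution_aux)
       (auto intro!: derivative_eq_intros continuous_intros mult_nonneg_nonneg sin_ge_zero
           cos_ge_zero simp: field_simps)
  also have "\<dots> = (\<integral>\<^sup>+\<theta>. ?s \<theta> * indicator {0<..pi} \<theta> \<partial>lborel)"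
  proof (intro nn_integral_cong_AE)
    \<comment> \<open>At \<open>pi\<close> the left integrand is 0 and the right one is 1, so the
      identity is claimed only off the endpoints.\<close>
    have "AE \<theta> in lborel. \<theta> \<noteq> (0::real)" "AE \<theta> in lborel. \<theta> \<noteq> pi"
      by (rule AE_lborel_singleton)+
    then show "AE \<theta> in lborel. ?f ((sin (\<theta> / 2))\<^sup>2) * ennreal (sin (\<theta> / 2) * cos (\<theta> / 2)) *
        indicator {0..pi} \<theta> =
        ?s \<theta> * indicator {0<..pi} \<theta>"
    proof eventually_elim
      case (elim \<theta>)
      show ?case
      proof (cases "\<theta> \<in> {0<..<pi}")
        case True
        then have s: "0 < sin (\<theta> / 2)" and c: "0 < cos (\<theta> / 2)"
          by (auto intro!: sin_gt_zero cos_gt_zero)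
        have cos_factor: "(1 - (sin (\<theta> / 2))\<^sup>2) powr (1 / 2 - 1) = inverse (cos (\<theta> / 2))"
          using c by (simp add: cos_squared_eq[symmetric] powr_powr powr_minus flip: powr_numeral)
        have sin_factor: "((sin (\<theta> / 2))\<^sup>2) powr ((1 - \<beta>) / 2 - 1) * sin (\<theta> / 2) =
            sin (\<theta> / 2) powr (-\<beta>)"
        proof -
          have "((sin (\<theta> / 2))\<^sup>2) powr ((1 - \<beta>) / 2 - 1) = sin (\<theta> / 2) powr (2 * ((1 - \<beta>) / 2 - 1))"
            using s by (simp only: powr_powr powr_numeral[symmetric])
          also have "2 * ((1 - \<beta>) / 2 - 1) = -\<beta> - 1"
            by (simp add: field_simps)
          finally show ?thesis using s by (simp add: powr_diff)
        qed
        have "a * b * (x * y) = (a * x) * (b * y)" for a b x y :: real by simp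
        then have "((sin (\<theta> / 2))\<^sup>2) powr ((1 - \<beta>) / 2 - 1) * (1 - (sin (\<theta> / 2))\<^sup>2) powr (1 / 2 - 1) *
            (sin (\<theta> / 2) * cos (\<theta> / 2)) = sin (\<theta> / 2) powr (-\<beta>)"
          using c by (simp only: cos_factor sin_factor) simp
        then show ?thesis
          using True s c by (simp flip: ennreal_mult)
      qed (use elim in \<open>auto simp: indicator_def\<close>)
    qed
  qed
  finally have half: "(\<integral>\<^sup>+\<theta>. ?s \<theta> * indicator {0<..pi} \<theta> \<partial>lborel) =
      ennreal (Beta ((1 - \<beta>) / 2) (1 / 2))"
    using beta by simp
  have "(\<integral>\<^sup>+\<theta>. ?s \<theta> * indicator {pi<..<2 * pi} \<theta> \<partial>lborel) =
      (\<integral>\<^sup>+\<theta>. ?s (2 * pi - \<theta>) * indicator {pi<..<2 * pi} (2 * pi - \<theta>) \<partial>lborel)"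
    by (subst nn_integral_real_affine[where c = "-1" and t = "2 * pi"]) auto
  also have "\<dots> = (\<integral>\<^sup>+\<theta>. ?s \<theta> * indicator {0<..pi} \<theta> \<partial>lborel)"
  proof (intro nn_integral_cong_AE)
    have "AE \<theta> in lborel. \<theta> \<noteq> pi" by (rule AE_lborel_singleton)
    then show "AE \<theta> in lborel. ?s (2 * pi - \<theta>) * indicator {pi<..<2 * pi} (2 * pi - \<theta>) =
        ?s \<theta> * indicator {0<..pi} \<theta>"
      by eventually_elim (auto simp: indicator_def diff_divide_distrib)
  qed
  finally have half2: "(\<integral>\<^sup>+\<theta>. ?s \<theta> * indicator {pi<..<2 * pi} \<theta> \<partial>lborel) =
      ennreal (Beta ((1 - \<beta>) / 2) (1 / 2))"
    using half by simp
  have "(\<integral>\<^sup>+\<theta>. ?s \<theta> * indicator {0<..<2 * pi} \<theta> \<partial>lborel) =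
      (\<integral>\<^sup>+\<theta>. ?s \<theta> * indicator {0<..pi} \<theta> + ?s \<theta> * indicator {pi<..<2 * pi} \<theta> \<partial>lborel)"
    by (intro nn_integral_cong) (auto simp: indicator_def)
  also have "\<dots> = ennreal (Beta ((1 - \<beta>) / 2) (1 / 2)) + ennreal (Beta ((1 - \<beta>) / 2) (1 / 2))"
    by (subst nn_integral_add) (auto simp: half half2)
  finally show ?thesis using Beta_pos by (simp flip: ennreal_plus)
qed

lemma nn_integral_exp_decay:
  fixes c :: real
  assumes "0 < c"
  shows "(\<integral>\<^sup>+t. ennreal (exp (- c * t)) * indicator {0..} t \<partial>lborel) = ennreal (1 / c)"
proof -
  have "((\<lambda>t. - exp (- c * t) / c) \<longlongrightarrow> 0) at_top" using assms by real_asymp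
  then have "(\<integral>\<^sup>+t. ennreal (exp (- c * t)) * indicator {0..} t \<partial>lborel) =
      ennreal (0 - (- exp (- c * 0) / c))"
    using assms by (intro nn_integral_FTC_atLeast) (auto intro!: derivative_eq_intros)
  then show ?thesis by simp
qed

section \<open>Hyperbolic distance of points far from the origin\<close>

lemma one_minus_cos: "1 - cos \<theta> = 2 * (sin (\<theta> / 2))\<^sup>2" for \<theta> :: real
  using cos_double_sin[of "\<theta> / 2"] by simp

lemma exp_hyp_dist:
  fixes \<zeta> r r' \<theta> :: real
  defines "X \<equiv> cosh (\<zeta> * r) * cosh (\<zeta> * r') - sinh (\<zeta> * r) * sinh (\<zeta> * r') * cos \<theta>"
  assumes "0 < \<zeta>" "0 \<le> r" "0 \<le> r'"
  shows "1 \<le> X" and "exp (\<zeta> * hyp_dist \<zeta> (r, 0) (r', \<theta>)) = X + sqrt (X\<^sup>2 - 1)"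
proof -
  have "X = cosh (\<zeta> * hyp_dist \<zeta> (r, 0) (r', \<theta>))"
    using cosh_hyp_dist[of \<zeta> "(r, 0)" "(r', \<theta>)"] assms by (simp add: cos_rel_angle)
  then show X: "1 \<le> X" by (simp add: cosh_real_ge_1)
  moreover have "0 < X + sqrt (X\<^sup>2 - 1)" using X by (intro add_pos_nonneg) auto
  moreover have "\<zeta> * hyp_dist \<zeta> (r, 0) (r', \<theta>) = arcosh X"
    using assms(2) by (simp add: hyp_dist_def cos_rel_angle X_def)
  ultimately show "exp (\<zeta> * hyp_dist \<zeta> (r, 0) (r', \<theta>)) = X + sqrt (X\<^sup>2 - 1)"
    by (simp add: arcosh_real_def)
qed

text \<open>Since \<open>cosh x\<close> is at least \<open>exp x / 2\<close>, the product
  \<open>C\<close> of the two factors is at least a quarter of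
  \<open>exp (\<zeta> * (r + r'))\<close>; this is the constant 1/4. The bound holds for all
  nonnegative radii and feeds the dominating function.\<close>

lemma exp_hyp_dist_ge:
  assumes "0 < \<zeta>" "0 \<le> r" "0 \<le> r'"
  shows "exp (\<zeta> * (r + r')) * ((sin (\<theta> / 2))\<^sup>2 / 4) \<le> exp (\<zeta> * hyp_dist \<zeta> (r, 0) (r', \<theta>))"
proof -
  define C S where "C = cosh (\<zeta> * r) * cosh (\<zeta> * r')" and "S = sinh (\<zeta> * r) * sinh (\<zeta> * r')"
  define X where "X = C - S * cos \<theta>"
  have S: "0 \<le> S" "S \<le> C"
    unfolding S_def C_def using assms
    by (auto intro!: mult_mono sinh_le_cosh_real)
  have sin1: "(sin (\<theta> / 2))\<^sup>2 \<le> 1" by (simp add: power_le_one_iff abs_square_le_1)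
  have "exp (\<zeta> * r) / 2 * (exp (\<zeta> * r') / 2) \<le> C"
    unfolding C_def by (intro mult_mono) (auto simp: cosh_field_def)
  then have "exp (\<zeta> * (r + r')) * ((sin (\<theta> / 2))\<^sup>2 / 4) \<le> C * (sin (\<theta> / 2))\<^sup>2"
    using mult_right_mono[of "exp (\<zeta> * r) / 2 * (exp (\<zeta> * r') / 2)" C "(sin (\<theta> / 2))\<^sup>2"]
    by (simp add: exp_add distrib_left field_simps)
  \<comment> \<open>For a nonnegative cosine \<open>S \<le> C\<close> gives
    \<open>X \<ge> C * (1 - cos \<theta>)\<close>, twice what is wanted; otherwise already
    \<open>X \<ge> C\<close>.\<close>
  also have "\<dots> \<le> X"
  proof (cases "cos \<theta> \<ge> 0")
    case True
    then have "S * cos \<theta> \<le> C * cos \<theta>" using S by (intro mult_right_mono)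
    moreover have "C * (1 - cos \<theta>) = 2 * (C * (sin (\<theta> / 2))\<^sup>2)" by (simp add: one_minus_cos)
    moreover have "0 \<le> C * (sin (\<theta> / 2))\<^sup>2" using S by simp
    ultimately show ?thesis by (simp add: X_def right_diff_distrib)
  next
    case False
    then have "S * cos \<theta> \<le> 0" using S by (simp add: mult_nonneg_nonpos)
    moreover have "C * (sin (\<theta> / 2))\<^sup>2 \<le> C * 1" using S sin1 by (intro mult_left_mono) auto
    ultimately show ?thesis by (simp add: X_def)
  qed
  also have "X \<le> exp (\<zeta> * hyp_dist \<zeta> (r, 0) (r', \<theta>))"
    using exp_hyp_dist[OF assms, of \<theta>] by (simp add: X_def C_def S_def)
  finally show ?thesis .
qed

text \<open>Scaling \<open>X\<close> by \<open>exp (- (\<zeta> * (r n + r' n)))\<close> leaves a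
  polynomial in two vanishing exponentials, with limit \<open>(1 - cos \<theta>) / 4\<close>, half
  of the claimed limit. The square root in \<open>X + sqrt (X\<^sup>2 - 1)\<close> contributes the
  other half.\<close>

lemma tendsto_exp_hyp_dist:
  assumes "0 < \<zeta>" and r: "filterlim r at_top F" and r': "filterlim r' at_top F"
  shows "((\<lambda>n. exp (\<zeta> * (hyp_dist \<zeta> (r n, 0) (r' n, \<theta>) - r n - r' n))) \<longlongrightarrow> (sin (\<theta> / 2))\<^sup>2) F"
proof -
  define X where "X = (\<lambda>n. cosh (\<zeta> * r n) * cosh (\<zeta> * r' n) - sinh (\<zeta> * r n) * sinh (\<zeta> * r' n) *
      cos \<theta>)"
  define e where "e = (\<lambda>n. exp (- (\<zeta> * (r n + r' n))))"
  have "((\<lambda>x. exp (- (\<zeta> * x))) \<longlongrightarrow> 0) at_top" using assms(1) by real_asymp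
  from filterlim_compose[OF this r] filterlim_compose[OF this r']
  have e: "((\<lambda>n. exp (- (\<zeta> * r n))) \<longlongrightarrow> 0) F" "((\<lambda>n. exp (- (\<zeta> * r' n))) \<longlongrightarrow> 0) F" by auto
  have Xe: "X n * e n = ((1 + (exp (- (\<zeta> * r n)))\<^sup>2) * (1 + (exp (- (\<zeta> * r' n)))\<^sup>2)
      - (1 - (exp (- (\<zeta> * r n)))\<^sup>2) * (1 - (exp (- (\<zeta> * r' n)))\<^sup>2) * cos \<theta>) / 4" for n
  proof -
    have ch: "cosh x * exp (- x) = (1 + (exp (- x))\<^sup>2) / 2" "sinh x * exp (- x) =
        (1 - (exp (- x))\<^sup>2) / 2" for x :: real
      by (simp_all add: cosh_field_def sinh_field_def exp_minus field_simps power2_eq_square)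
    have "e n = exp (- (\<zeta> * r n)) * exp (- (\<zeta> * r' n))"
      by (simp add: e_def distrib_left flip: exp_add)
    then have "X n * e n =
        (cosh (\<zeta> * r n) * exp (- (\<zeta> * r n))) * (cosh (\<zeta> * r' n) * exp (- (\<zeta> * r' n)))
        - (sinh (\<zeta> * r n) * exp (- (\<zeta> * r n))) * (sinh (\<zeta> * r' n) * exp (- (\<zeta> * r' n))) * cos \<theta>"
      by (simp add: X_def algebra_simps)
    then show ?thesis unfolding ch by (simp add: field_simps)
  qed
  have "((\<lambda>n. X n * e n) \<longlongrightarrow> ((1 + 0\<^sup>2) * (1 + 0\<^sup>2) - (1 - 0\<^sup>2) * (1 - 0\<^sup>2) * cos \<theta>) / 4) F"
    unfolding Xe by (intro tendsto_intros e) auto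
  then have lim: "((\<lambda>n. X n * e n) \<longlongrightarrow> (sin (\<theta> / 2))\<^sup>2 / 2) F"
    using one_minus_cos[of \<theta>] by simp
  have e0: "(e \<longlongrightarrow> 0) F"
    using tendsto_mult[OF e] by (simp add: e_def distrib_left flip: exp_add)
  have "((\<lambda>n. X n * e n + sqrt ((X n * e n)\<^sup>2 - (e n)\<^sup>2)) \<longlongrightarrow>
      (sin (\<theta> / 2))\<^sup>2 / 2 + sqrt (((sin (\<theta> / 2))\<^sup>2 / 2)\<^sup>2 - 0\<^sup>2)) F"
    by (intro tendsto_intros lim e0)
  then have "((\<lambda>n. X n * e n + sqrt ((X n * e n)\<^sup>2 - (e n)\<^sup>2)) \<longlongrightarrow> (sin (\<theta> / 2))\<^sup>2) F"
    by (simp add: real_sqrt_divide)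
  \<comment> \<open>\<open>exp_hyp_dist\<close> asks for nonnegative radii, so this identity holds
    only eventually.\<close>
  moreover have "\<forall>\<^sub>F n in F. X n * e n + sqrt ((X n * e n)\<^sup>2 - (e n)\<^sup>2) =
      exp (\<zeta> * (hyp_dist \<zeta> (r n, 0) (r' n, \<theta>) - r n - r' n))"
  proof -
    have "\<forall>\<^sub>F n in F. 0 \<le> r n" "\<forall>\<^sub>F n in F. 0 \<le> r' n"
      using r r' by (auto simp: filterlim_at_top)
    then show ?thesis
    proof eventually_elim
      case (elim n)
      have "(X n * e n)\<^sup>2 - (e n)\<^sup>2 = ((X n)\<^sup>2 - 1) * (e n)\<^sup>2" by (simp add: algebra_simps)
      then have "sqrt ((X n * e n)\<^sup>2 - (e n)\<^sup>2) = sqrt ((X n)\<^sup>2 - 1) * e n"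
        by (simp add: real_sqrt_mult e_def)
      then have "X n * e n + sqrt ((X n * e n)\<^sup>2 - (e n)\<^sup>2) =
          exp (\<zeta> * hyp_dist \<zeta> (r n, 0) (r' n, \<theta>)) * e n"
        using exp_hyp_dist(2)[OF assms(1) elim, of \<theta>] by (simp add: X_def distrib_right)
      then show ?case
        by (simp add: e_def algebra_simps flip: exp_add)
    qed
  qed
  ultimately show ?thesis by (rule Lim_transform_eventually)
qed

section \<open>Density of the type of a vertex\<close>

lemma radius_density_nonneg:
  assumes "0 < \<alpha>"
  shows "0 \<le> radius_density N \<zeta> \<alpha> r"
  using assms cosh_real_ge_1[of "\<alpha> * disc_radius \<zeta> N"]
  by (auto simp: radius_density_def indicator_def intro!: mult_nonneg_nonneg divide_nonneg_nonneg)

text \<open>\<open>sinh x\<close> is at most \<open>exp x / 2\<close>, and \<open>cosh x - 1\<close>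
  is at least \<open>exp x / 4\<close> once \<open>exp x\<close> is at least 4. The quotient of 1/2
  and 1/4 is the constant 2.\<close>

lemma radius_density_le:
  assumes "0 < \<alpha>" "4 \<le> exp (\<alpha> * disc_radius \<zeta> N)"
  shows "radius_density N \<zeta> \<alpha> (disc_radius \<zeta> N - t) \<le> 2 * \<alpha> * exp (- \<alpha> * t) * indicator {0..} t"
proof (cases "t \<in> {0..disc_radius \<zeta> N}")
  case True
  let ?R = "disc_radius \<zeta> N"
  have c: "exp (\<alpha> * ?R) / 4 \<le> cosh (\<alpha> * ?R) - 1"
  proof -
    have "x / 4 \<le> (x + y) / 2 - 1" if "4 \<le> x" "0 < y" for x y :: real
      using that by (simp add: field_simps)
    from this[OF assms(2) exp_gt_zero, of "- (\<alpha> * ?R)"] show ?thesis by (simp only: cosh_field_def)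
  qed
  have "sinh (\<alpha> * (?R - t)) \<le> exp (\<alpha> * (?R - t)) / 2"
    by (simp add: sinh_field_def)
  then have "sinh (\<alpha> * (?R - t)) / (cosh (\<alpha> * ?R) - 1) \<le>
      (exp (\<alpha> * (?R - t)) / 2) / (exp (\<alpha> * ?R) / 4)"
    using c by (intro frac_le) auto
  also have "\<dots> = 2 * exp (- \<alpha> * t)"
    by (simp add: right_diff_distrib exp_diff exp_minus field_simps)
  finally have "\<alpha> * (sinh (\<alpha> * (?R - t)) / (cosh (\<alpha> * ?R) - 1)) \<le> \<alpha> * (2 * exp (- \<alpha> * t))"
    using assms(1) by (intro mult_left_mono) auto
  then show ?thesis
    using True by (simp add: radius_density_def)
qed (auto simp: radius_density_def indicator_def assms intro!: mult_nonneg_nonneg less_imp_le)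

text \<open>The limit is the exponential density of rate \<alpha>. For negative \<open>t\<close> the
  radius exceeds that of the disc and both sides are 0.\<close>

lemma tendsto_radius_density:
  assumes "0 < \<alpha>" "0 < \<zeta>"
  shows "(\<lambda>N. radius_density N \<zeta> \<alpha> (disc_radius \<zeta> N - t)) \<longlonglongrightarrow> \<alpha> * exp (- \<alpha> * t) * indicator {0..} t"
proof (cases "0 \<le> t")
  case True
  have R: "filterlim (disc_radius \<zeta>) at_top sequentially"
    unfolding disc_radius_def using assms by real_asymp
  have "((\<lambda>x. \<alpha> * (((exp (\<alpha> * (x - t)) - exp (- (\<alpha> * (x - t)))) / 2) /
      ((exp (\<alpha> * x) + exp (- (\<alpha> * x))) / 2 - 1))) \<longlongrightarrow> \<alpha> * exp (- \<alpha> * t)) at_top"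
    using assms(1) by (real_asymp simp: exp_diff exp_minus field_simps)
  then have "((\<lambda>x. \<alpha> * (sinh (\<alpha> * (x - t)) / (cosh (\<alpha> * x) - 1))) \<longlongrightarrow> \<alpha> * exp (- \<alpha> * t)) at_top"
    by (simp add: sinh_field_def cosh_field_def)
  from filterlim_compose[OF this R]
  have "(\<lambda>N. \<alpha> * (sinh (\<alpha> * (disc_radius \<zeta> N - t)) / (cosh (\<alpha> * disc_radius \<zeta> N) - 1))) \<longlonglongrightarrow>
      \<alpha> * exp (- \<alpha> * t)" .
  moreover have "\<forall>\<^sub>F N in sequentially. \<alpha> * (sinh (\<alpha> * (disc_radius \<zeta> N - t)) / (cosh (\<alpha> *
      disc_radius \<zeta> N) - 1)) =
      radius_density N \<zeta> \<alpha> (disc_radius \<zeta> N - t)"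
    using R[unfolded filterlim_at_top, rule_format, of t]
    by eventually_elim (use True in \<open>simp add: radius_density_def\<close>)
  ultimately show ?thesis using True by (simp add: Lim_transform_eventually)
qed (simp add: radius_density_def)

section \<open>The rescaled connection probability\<close>

text \<open>With \<open>r' = R - t\<close> one has \<open>d - R = (d - r - r') + r - t\<close>. The
  scaling cancels the summand \<open>r\<close>, isolates the factor that has a limit, and turns the
  1 in the denominator into a term that vanishes as \<open>r\<close> grows.\<close>

lemma scaled_conn_prob:
  "exp (\<beta> * \<zeta> / 2 * r) * conn_prob N \<zeta> \<beta> (r, 0) (disc_radius \<zeta> N - t, \<theta>) =
    1 / (exp (- (\<beta> * \<zeta> / 2 * t)) *
      exp (\<zeta> * (hyp_dist \<zeta> (r, 0) (disc_radius \<zeta> N - t, \<theta>) - r - (disc_radius \<zeta> N - t))) powr (\<beta> /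
          2)
      + exp (- (\<beta> * \<zeta> / 2 * r)))"
proof -
  let ?R = "disc_radius \<zeta> N"
  let ?d = "hyp_dist \<zeta> (r, 0) (?R - t, \<theta>)"
  let ?A = "exp (\<beta> * (\<zeta> / 2) * (?d - ?R))"
  have "exp (- (\<beta> * \<zeta> / 2 * t)) * exp (\<zeta> * (?d - r - (?R - t))) powr (\<beta> / 2) =
      exp (\<beta> * (\<zeta> / 2) * (?d - ?R)) * exp (- (\<beta> * \<zeta> / 2 * r))"
    by (simp add: exp_powr_real algebra_simps flip: exp_add)
  then have "exp (- (\<beta> * \<zeta> / 2 * t)) * exp (\<zeta> * (?d - r - (?R - t))) powr (\<beta> / 2)
      + exp (- (\<beta> * \<zeta> / 2 * r)) = (?A + 1) * exp (- (\<beta> * \<zeta> / 2 * r))"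
    by (simp only: distrib_right mult_1)
  moreover have "exp x * (1 / y) = 1 / (y * exp (- x))" for x y :: real
    by (simp add: exp_minus divide_inverse mult.commute)
  ultimately show ?thesis
    unfolding conn_prob_def by (simp only:)
qed

text \<open>Drop the last term of the denominator in \<open>scaled_conn_prob\<close> and insert
  \<open>exp_hyp_dist_ge\<close>, read as a lower bound by the square of
  \<open>sin (\<theta> / 2) / 2\<close>; the inner 2 becomes \<open>2 powr \<beta>\<close>. The
  condition on \<open>t\<close> makes the second radius nonnegative.\<close>

lemma scaled_conn_prob_le:
  assumes "0 < \<zeta>" "0 < \<beta>" "0 \<le> r" "t \<le> disc_radius \<zeta> N" "0 < sin (\<theta> / 2)"
  shows "exp (\<beta> * \<zeta> / 2 * r) * conn_prob N \<zeta> \<beta> (r, 0) (disc_radius \<zeta> N - t, \<theta>) \<le>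
    2 powr \<beta> * exp (\<beta> * \<zeta> / 2 * t) * sin (\<theta> / 2) powr (- \<beta>)"
proof -
  let ?R = "disc_radius \<zeta> N"
  let ?Z = "exp (\<zeta> * (hyp_dist \<zeta> (r, 0) (?R - t, \<theta>) - r - (?R - t)))"
  have "(sin (\<theta> / 2) / 2) powr 2 \<le> ?Z"
    using exp_hyp_dist_ge[of \<zeta> r "?R - t" \<theta>] assms
    by (simp add: powr_numeral power_divide exp_diff exp_add right_diff_distrib distrib_left
        field_simps)
  then have "((sin (\<theta> / 2) / 2) powr 2) powr (\<beta> / 2) \<le> ?Z powr (\<beta> / 2)"
    using assms by (intro powr_mono2) auto
  then have "(sin (\<theta> / 2) / 2) powr \<beta> \<le> ?Z powr (\<beta> / 2)"
    by (simp only: powr_powr) simp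
  then have "exp (- (\<beta> * \<zeta> / 2 * t)) * (sin (\<theta> / 2) / 2) powr \<beta> \<le>
      exp (- (\<beta> * \<zeta> / 2 * t)) * ?Z powr (\<beta> / 2)"
    by (rule mult_left_mono) simp
  also have "\<dots> \<le> exp (- (\<beta> * \<zeta> / 2 * t)) * ?Z powr (\<beta> / 2) + exp (- (\<beta> * \<zeta> / 2 * r))"
    by simp
  finally have "exp (\<beta> * \<zeta> / 2 * r) * conn_prob N \<zeta> \<beta> (r, 0) (?R - t, \<theta>) \<le>
      1 / (exp (- (\<beta> * \<zeta> / 2 * t)) * (sin (\<theta> / 2) / 2) powr \<beta>)"
    unfolding scaled_conn_prob using assms
        by (intro divide_left_mono) (auto intro!: mult_pos_pos add_nonneg_pos)
  also have "\<dots> = 2 powr \<beta> * exp (\<beta> * \<zeta> / 2 * t) * sin (\<theta> / 2) powr (- \<beta>)"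
    using assms by (simp add: powr_divide powr_minus exp_minus field_simps)
  finally show ?thesis .
qed

lemma tendsto_scaled_conn_prob:
  assumes "0 < \<zeta>" "0 < \<beta>" "0 < sin (\<theta> / 2)" and r: "filterlim r at_top sequentially"
  shows "(\<lambda>N. exp (\<beta> * \<zeta> / 2 * r N) * conn_prob N \<zeta> \<beta> (r N, 0) (disc_radius \<zeta> N - t, \<theta>))
    \<longlonglongrightarrow> exp (\<beta> * \<zeta> / 2 * t) * sin (\<theta> / 2) powr (- \<beta>)"
proof -
  have R: "filterlim (\<lambda>N. disc_radius \<zeta> N - t) at_top sequentially"
    unfolding disc_radius_def using assms by real_asymp
  have "((\<lambda>x. exp (- (\<beta> * \<zeta> / 2 * x))) \<longlongrightarrow> 0) at_top" using assms by real_asymp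
  from filterlim_compose[OF this r] have "(\<lambda>N. exp (- (\<beta> * \<zeta> / 2 * r N))) \<longlonglongrightarrow> 0" .
  moreover have "((sin (\<theta> / 2))\<^sup>2) powr (\<beta> / 2) = sin (\<theta> / 2) powr \<beta>"
    using assms by (simp add: powr_powr flip: powr_numeral)
  ultimately have "(\<lambda>N. exp (\<beta> * \<zeta> / 2 * r N) * conn_prob N \<zeta> \<beta> (r N, 0) (disc_radius \<zeta> N - t, \<theta>))
      \<longlonglongrightarrow> 1 / (exp (- (\<beta> * \<zeta> / 2 * t)) * ((sin (\<theta> / 2))\<^sup>2) powr (\<beta> / 2) + 0)"
    unfolding scaled_conn_prob using assms
    by (intro tendsto_divide tendsto_add tendsto_mult tendsto_const tendsto_powr
        tendsto_exp_hyp_dist R r) auto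
  then show ?thesis
    using \<open>((sin (\<theta> / 2))\<^sup>2) powr (\<beta> / 2) = sin (\<theta> / 2) powr \<beta>\<close>
    by (simp add: powr_minus exp_minus field_simps)
qed

section \<open>Limit of the link probability, first along sequences and then uniformly\<close>

text \<open>The radii form an arbitrary sequence tending to infinity, so that the least favourable
  ones can be inserted later.\<close>

lemma tendsto_link_prob:
  assumes "0 < \<zeta>" "0 < \<alpha>" "0 < \<beta>" "\<beta> < 1" "\<beta> * \<zeta> < 2 * \<alpha>"
    and r: "filterlim r at_top sequentially"
  shows "(\<lambda>N. exp (\<beta> * \<zeta> / 2 * r N) * link_prob N \<zeta> \<alpha> \<beta> (r N)) \<longlonglongrightarrow> K_const \<zeta> \<alpha> \<beta>"
proof -
  define R where "R = disc_radius \<zeta>"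
  define c where "c = \<alpha> - \<beta> * \<zeta> / 2"
  have c: "0 < c" using assms by (simp add: c_def)
  have Rlim: "filterlim R at_top sequentially"
    unfolding R_def disc_radius_def using assms by real_asymp
  \<comment> \<open>\<open>U N\<close> is the rescaled joint integrand in the type and angle of the
    second vertex, \<open>L\<close> its pointwise limit. Both are cut to the open interval of
    angles, where \<open>sin (\<theta> / 2)\<close> is positive.\<close>
  define U where "U = (\<lambda>N (t, \<theta>). (exp (\<beta> * \<zeta> / 2 * r N) * conn_prob N \<zeta> \<beta> (r N, 0) (R N - t, \<theta>)) *
    radius_density N \<zeta> \<alpha> (R N - t) * (indicator {0<..<2 * pi} \<theta> / (2 * pi)))"
  define L where "L = (\<lambda>(t, \<theta>). (exp (\<beta> * \<zeta> / 2 * t) * sin (\<theta> / 2) powr (- \<beta>)) *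
    (\<alpha> * exp (- \<alpha> * t) * indicator {0..} t) * (indicator {0<..<2 * pi} \<theta> / (2 * pi)))"
  have [measurable]: "U N \<in> borel_measurable (lborel \<Otimes>\<^sub>M lborel)" for N
    unfolding U_def by measurable
  have [measurable]: "L \<in> borel_measurable (lborel \<Otimes>\<^sub>M lborel)"
    unfolding L_def by measurable
  have L_nonneg: "0 \<le> L p" for p
    using assms by (cases p) (simp add: L_def)
  have sin_pos: "0 < sin (\<theta> / 2)" if "\<theta> \<in> {0<..<2 * pi}" for \<theta>
    using that by (auto intro!: sin_gt_zero)

  have lim: "(\<lambda>N. U N p) \<longlonglongrightarrow> L p" for p
  proof (cases p)
    case (Pair t \<theta>)
    show ?thesis
    proof (cases "\<theta> \<in> {0<..<2 * pi}")
      case True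
      show ?thesis
        unfolding Pair U_def L_def case_prod_conv R_def using assms sin_pos[OF True]
        by (intro tendsto_mult tendsto_const tendsto_scaled_conn_prob tendsto_radius_density r)
    qed (simp add: U_def L_def Pair)
  qed
  \<comment> \<open>The dominating function is a multiple of the limit:
    \<open>2 powr \<beta>\<close> comes from \<open>scaled_conn_prob_le\<close>, the other 2 from
    \<open>radius_density_le\<close>.\<close>
  have bound: "U N p \<le> 2 * 2 powr \<beta> * L p" if N: "0 \<le> r N" "4 \<le> exp (\<alpha> * R N)" for N p
  proof (cases p)
    case (Pair t \<theta>)
    show ?thesis
    proof (cases "\<theta> \<in> {0<..<2 * pi} \<and> t \<in> {0..R N}")
      case True
      have "U N p \<le> (2 powr \<beta> * exp (\<beta> * \<zeta> / 2 * t) * sin (\<theta> / 2) powr (- \<beta>)) *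
          (2 * \<alpha> * exp (- \<alpha> * t) * indicator {0..} t) * (indicator {0<..<2 * pi} \<theta> / (2 * pi))"
        unfolding U_def Pair case_prod_conv R_def using assms N True sin_pos[of \<theta>]
        by (intro mult_mono scaled_conn_prob_le radius_density_le radius_density_nonneg)
           (auto simp: R_def conn_prob_bounds radius_density_nonneg)
      also have "\<dots> = 2 * 2 powr \<beta> * L p"
        by (simp add: L_def Pair)
      finally show ?thesis .
    next
      case False
      then have "U N p = 0" by (auto simp: U_def Pair radius_density_def R_def)
      then show ?thesis using L_nonneg[of p] by simp
    qed
  qed
  have L_int: "(\<integral>\<^sup>+p. ennreal (L p) \<partial>(lborel \<Otimes>\<^sub>M lborel)) = ennreal (K_const \<zeta> \<alpha> \<beta>)"
  proof -
    let ?s = "\<lambda>\<theta>. ennreal (sin (\<theta> / 2) powr (- \<beta>)) * indicator {0<..<2 * pi} \<theta>"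
    let ?B = "Beta ((1 - \<beta>) / 2) (1 / 2)"
    have B: "0 \<le> ?B"
      unfolding Beta_def using assms
      by (intro divide_nonneg_nonneg mult_nonneg_nonneg Gamma_real_nonneg) (auto simp: field_simps)
    \<comment> \<open>The variables separate, and the two exponentials in \<open>t\<close> combine
      to decay at rate \<open>c\<close>, positive because
      \<open>\<beta> * \<zeta> < 2 * \<alpha>\<close>.\<close>
    have L_eq: "ennreal (L (t, \<theta>)) = ennreal (\<alpha> / (2 * pi)) * (ennreal (exp (- c * t)) *
        indicator {0..} t) * ?s \<theta>" for t \<theta>
      using assms
      by (auto simp: L_def c_def indicator_def algebra_simps exp_diff exp_minus divide_simps simp
          flip: ennreal_mult exp_add)
    have "(\<integral>\<^sup>+p. ennreal (L p) \<partial>(lborel \<Otimes>\<^sub>M lborel)) = (\<integral>\<^sup>+t. \<integral>\<^sup>+\<theta>. ennreal (L (t, \<theta>)) \<partial>lborel \<partial>lborel)"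
      by (rule lborel.nn_integral_fst[symmetric]) simp
    also have "\<dots> = (\<integral>\<^sup>+t. ennreal (\<alpha> / (2 * pi)) * (ennreal (exp (- c * t)) * indicator {0..} t) *
        ennreal (2 * ?B) \<partial>lborel)"
      unfolding L_eq using assms(4)
      by (intro nn_integral_cong, subst nn_integral_cmult) (auto simp: nn_integral_sin_powr)
    also have "\<dots> = ennreal (\<alpha> / (2 * pi)) * ennreal (1 / c) * ennreal (2 * ?B)"
      by (subst nn_integral_multc, simp, subst nn_integral_cmult, simp) (simp only:
          nn_integral_exp_decay[OF c])
    also have "\<dots> = ennreal (\<alpha> / (2 * pi) * (1 / c) * (2 * ?B))"
      using assms c B by (simp flip: ennreal_mult)
    also have "\<alpha> / (2 * pi) * (1 / c) * (2 * ?B) = K_const \<zeta> \<alpha> \<beta>"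
    proof -
      have "\<alpha> / c = 2 * \<alpha> / (2 * \<alpha> - \<beta> * \<zeta>)"
        using c by (simp add: c_def field_simps)
      \<comment> \<open>\<open>Gamma (1 / 2) = sqrt pi\<close> turns the Beta value into the
        quotient of Gammas in \<open>K_const\<close>.\<close>
      moreover have "?B / pi = 1 / sqrt pi * (Gamma ((1 - \<beta>) / 2) / Gamma (1 - \<beta> / 2))"
      proof -
        have "(1 - \<beta>) / 2 + 1 / 2 = 1 - \<beta> / 2" by (simp add: field_simps)
        then have "?B / pi = sqrt pi / pi * (Gamma ((1 - \<beta>) / 2) / Gamma (1 - \<beta> / 2))"
          by (simp add: Beta_def Gamma_one_half_real mult.commute)
        also have "sqrt pi / pi = 1 / sqrt pi" by (simp add: field_simps)
        finally show ?thesis .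
      qed
      moreover have "\<alpha> / (2 * pi) * (1 / c) * (2 * ?B) = (\<alpha> / c) * (?B / pi)" by simp
      ultimately show ?thesis by (simp add: K_const_def)
    qed
    finally show ?thesis .
  qed

  have U_int: "(\<integral>\<^sup>+p. ennreal (U N p) \<partial>(lborel \<Otimes>\<^sub>M lborel)) =
      ennreal (exp (\<beta> * \<zeta> / 2 * r N) * link_prob N \<zeta> \<alpha> \<beta> (r N))"
    if N: "1 < N" for N
  proof -
    let ?e = "exp (\<beta> * \<zeta> / 2 * r N)" and ?\<rho> = "radius_density N \<zeta> \<alpha>"
    let ?c = "\<lambda>r' \<theta>. ennreal (conn_prob N \<zeta> \<beta> (r N, 0) (r', \<theta>))"
    let ?I = "\<lambda>r'. \<integral>\<^sup>+\<theta>. ?c r' \<theta> * indicator {0<..2 * pi} \<theta> \<partial>lborel"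
    have mult3: "ennreal (a * b * d) = ennreal a * ennreal b * ennreal d" if "0 \<le> a" "0 \<le> b" "0 \<le>
        d" for a b d
      using that by (simp add: ennreal_mult)
    have assoc: "a * b * (1 / d) * e = a * (b * (e / d))" for a b d e :: ennreal
      by (simp add: divide_ennreal_def mult_ac)
    have inner: "(\<integral>\<^sup>+\<theta>. ennreal (U N (t, \<theta>)) \<partial>lborel) =
        ennreal ?e * (ennreal (?\<rho> (R N - t)) * (?I (R N - t) / ennreal (2 * pi)))" for t
    proof -
      \<comment> \<open>The vertex law uses the half-open interval of angles and \<open>U\<close>
        the open one; they differ in the point \<open>2 * pi\<close>.\<close>
      have "AE \<theta> in lborel. \<theta> \<noteq> 2 * pi" by (rule AE_lborel_singleton)
      then have "(\<integral>\<^sup>+\<theta>. ennreal (U N (t, \<theta>)) \<partial>lborel) =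
          (\<integral>\<^sup>+\<theta>. ennreal (?e * ?\<rho> (R N - t) * (1 / (2 * pi))) * (?c (R N - t) \<theta> * indicator {0<..2
              * pi} \<theta>) \<partial>lborel)"
        by (intro nn_integral_cong_AE, eventually_elim)
           (auto simp: U_def indicator_def mult_ac radius_density_nonneg[OF assms(2)]
               conn_prob_bounds simp flip: ennreal_mult)
      also have "\<dots> = ennreal (?e * ?\<rho> (R N - t) * (1 / (2 * pi))) * ?I (R N - t)"
        by (intro nn_integral_cmult) measurable
      also have "ennreal (?e * ?\<rho> (R N - t) * (1 / (2 * pi))) =
          ennreal ?e * ennreal (?\<rho> (R N - t)) * ennreal (1 / (2 * pi))"
        by (rule mult3) (simp_all add: radius_density_nonneg[OF assms(2)])
      also have "ennreal (1 / (2 * pi)) = 1 / ennreal (2 * pi)"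
        using divide_ennreal[of 1 "2 * pi"] by simp
      finally show ?thesis by (simp only: assoc)
    qed
    have "ennreal (exp (\<beta> * \<zeta> / 2 * r N) * link_prob N \<zeta> \<alpha> \<beta> (r N)) =
        ennreal ?e * (\<integral>\<^sup>+z. ennreal (conn_prob N \<zeta> \<beta> (r N, 0) z) \<partial>vertex_law N \<zeta> \<alpha>)"
      using link_prob_bounds[OF assms(1,2) N]
          by (simp add: nn_integral_conn_prob[OF assms(1,2) N] ennreal_mult)
    also have "\<dots> = ennreal ?e * (\<integral>\<^sup>+r'. ennreal (?\<rho> r') * (?I r' / ennreal (2 * pi)) \<partial>lborel)"
      by (subst nn_integral_vertex_law) auto
    \<comment> \<open>Change of variable from the radius of the second vertex to its type.\<close>
    also have "\<dots> = ennreal ?e * (\<integral>\<^sup>+t. ennreal (?\<rho> (R N - t)) * (?I (R N - t) / ennreal (2 * pi))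
        \<partial>lborel)"
      by (subst nn_integral_real_affine[where c = "-1" and t = "R N"]) auto
    also have "\<dots> = (\<integral>\<^sup>+t. \<integral>\<^sup>+\<theta>. ennreal (U N (t, \<theta>)) \<partial>lborel \<partial>lborel)"
      unfolding inner by (intro nn_integral_cmult[symmetric]) measurable
    also have "\<dots> = (\<integral>\<^sup>+p. ennreal (U N p) \<partial>(lborel \<Otimes>\<^sub>M lborel))"
      by (rule lborel.nn_integral_fst) simp
    finally show ?thesis ..
  qed

  have "\<forall>\<^sub>F N in sequentially. 0 \<le> r N \<and> 4 \<le> exp (\<alpha> * R N) \<and> 1 < N"
  proof (intro eventually_conj)
    show "\<forall>\<^sub>F N in sequentially. 0 \<le> r N" using r by (simp add: filterlim_at_top)
    have "\<forall>\<^sub>F x in at_top. 4 \<le> exp (\<alpha> * x)" using assms by real_asymp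
    then show "\<forall>\<^sub>F N in sequentially. 4 \<le> exp (\<alpha> * R N)" using Rlim
        by (rule eventually_compose_filterlim)
  qed (rule eventually_gt_at_top)
  \<comment> \<open>The domination holds for large \<open>N\<close> only, while the convergence
    theorem asks for it at every index; hence the shift by \<open>N0\<close>.\<close>
  then obtain N0 where N0: "\<And>N. N0 \<le> N \<Longrightarrow> 0 \<le> r N \<and> 4 \<le> exp (\<alpha> * R N) \<and> 1 < N"
    by (auto simp: eventually_sequentially)
  have "(\<lambda>n. \<integral>\<^sup>+p. ennreal (U (n + N0) p) \<partial>(lborel \<Otimes>\<^sub>M lborel)) \<longlonglongrightarrow>
      (\<integral>\<^sup>+p. ennreal (L p) \<partial>(lborel \<Otimes>\<^sub>M lborel))"
  proof (rule nn_integral_dominated_convergence)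
    show "AE p in lborel \<Otimes>\<^sub>M lborel. ennreal (U (n + N0) p) \<le> ennreal (2 * 2 powr \<beta> * L p)" for n
      using bound N0[of "n + N0"] by (intro AE_I2 ennreal_leI) auto
    have "(\<integral>\<^sup>+p. ennreal (2 * 2 powr \<beta> * L p) \<partial>(lborel \<Otimes>\<^sub>M lborel)) =
        ennreal (2 * 2 powr \<beta>) * ennreal (K_const \<zeta> \<alpha> \<beta>)"
      using L_nonneg unfolding L_int[symmetric]
      by (subst nn_integral_cmult[symmetric]) (auto simp: ennreal_mult intro!: nn_integral_cong)
    then show "(\<integral>\<^sup>+p. ennreal (2 * 2 powr \<beta> * L p) \<partial>(lborel \<Otimes>\<^sub>M lborel)) < \<infinity>"
      by (simp add: ennreal_mult_less_top)
    show "AE p in lborel \<Otimes>\<^sub>M lborel. (\<lambda>n. ennreal (U (n + N0) p)) \<longlonglongrightarrow> ennreal (L p)"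
      using lim by (intro AE_I2 tendsto_ennrealI LIMSEQ_ignore_initial_segment)
  qed auto
  then have "(\<lambda>n. ennreal (exp (\<beta> * \<zeta> / 2 * r (n + N0)) * link_prob (n + N0) \<zeta> \<alpha> \<beta> (r (n + N0)))) \<longlonglongrightarrow>
      ennreal (K_const \<zeta> \<alpha> \<beta>)"
    using N0 by (simp add: U_int L_int)
  moreover have "0 \<le> K_const \<zeta> \<alpha> \<beta>"
    unfolding K_const_def using assms
    by (intro mult_nonneg_nonneg divide_nonneg_nonneg Gamma_real_nonneg) auto
  ultimately have "(\<lambda>n. exp (\<beta> * \<zeta> / 2 * r (n + N0)) * link_prob (n + N0) \<zeta> \<alpha> \<beta> (r (n + N0))) \<longlonglongrightarrow>
      K_const \<zeta> \<alpha> \<beta>"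
    using N0 link_prob_bounds(1)[OF assms(1,2)] by (subst (asm) tendsto_ennreal_iff) auto
  then show ?thesis by (rule LIMSEQ_offset)
qed

text \<open>Since \<open>a\<close> is positive, \<open>a * disc_radius \<zeta> N\<close> tends to
  infinity, so every choice of admissible radii is a sequence to which
  \<open>tendsto_link_prob\<close> applies.\<close>

lemma eventually_link_prob_bounds:
  assumes "0 < \<zeta>" "0 < \<alpha>" "0 < \<beta>" "\<beta> < 1" "\<beta> * \<zeta> < 2 * \<alpha>" "0 < a" "0 < \<epsilon>"
  shows "\<forall>\<^sub>F N in sequentially. \<forall>r. a * disc_radius \<zeta> N \<le> r \<longrightarrow>
    (1 - \<epsilon>) * (K_const \<zeta> \<alpha> \<beta> * exp (- (\<beta> * \<zeta> / 2 * r))) \<le> link_prob N \<zeta> \<alpha> \<beta> r \<and>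
    link_prob N \<zeta> \<alpha> \<beta> r \<le> (1 + \<epsilon>) * (K_const \<zeta> \<alpha> \<beta> * exp (- (\<beta> * \<zeta> / 2 * r)))"
proof -
  define K where "K = K_const \<zeta> \<alpha> \<beta>"
  define good where "good = (\<lambda>N r. (1 - \<epsilon>) * (K * exp (- (\<beta> * \<zeta> / 2 * r))) \<le> link_prob N \<zeta> \<alpha> \<beta> r \<and>
    link_prob N \<zeta> \<alpha> \<beta> r \<le> (1 + \<epsilon>) * (K * exp (- (\<beta> * \<zeta> / 2 * r))))"
  have K: "0 < K"
    unfolding K_def K_const_def using assms
    by (intro mult_pos_pos divide_pos_pos Gamma_real_pos) auto
  \<comment> \<open>Pointwise convergence along the worst radii gives uniformity in the radius.\<close>
  have worst: "\<exists>s\<ge>x. P s \<longrightarrow> (\<forall>s'\<ge>x. P s')" for P :: "real \<Rightarrow> bool" and x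
    by (cases "\<forall>s\<ge>x. P s") auto
  have "\<forall>N. \<exists>s. a * disc_radius \<zeta> N \<le> s \<and> (good N s \<longrightarrow> (\<forall>s'\<ge>a * disc_radius \<zeta> N. good N s'))"
    by (intro allI worst)
  from choice[OF this] obtain r
    where r_ge: "\<And>N. a * disc_radius \<zeta> N \<le> r N"
      and good: "\<And>N s. good N (r N) \<Longrightarrow> a * disc_radius \<zeta> N \<le> s \<Longrightarrow> good N s"
    by blast
  have "filterlim (\<lambda>N. a * disc_radius \<zeta> N) at_top sequentially"
    unfolding disc_radius_def using assms by real_asymp
  then have "filterlim r at_top sequentially"
    by (rule filterlim_at_top_mono) (simp add: r_ge)
  from tendsto_link_prob[OF assms(1-5) this]
  have "(\<lambda>N. exp (\<beta> * \<zeta> / 2 * r N) * link_prob N \<zeta> \<alpha> \<beta> (r N)) \<longlonglongrightarrow> K" by (simp add: K_def)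
  \<comment> \<open>The tolerance \<open>\<epsilon> * K\<close>, positive because \<open>K\<close>
    is, makes the error relative.\<close>
  then have "\<forall>\<^sub>F N in sequentially. dist (exp (\<beta> * \<zeta> / 2 * r N) * link_prob N \<zeta> \<alpha> \<beta> (r N)) K < \<epsilon> * K"
    by (rule tendstoD) (use K assms in simp)
  then show ?thesis
  proof eventually_elim
    case (elim N)
    let ?x = "exp (\<beta> * \<zeta> / 2 * r N) * link_prob N \<zeta> \<alpha> \<beta> (r N)" and ?e = "exp (- (\<beta> * \<zeta> / 2 * r N))"
    have "(1 - \<epsilon>) * K \<le> ?x" "?x \<le> (1 + \<epsilon>) * K"
      using elim by (simp_all add: dist_real_def abs_less_iff algebra_simps)
    then have "(1 - \<epsilon>) * K * ?e \<le> ?x * ?e" "?x * ?e \<le> (1 + \<epsilon>) * K * ?e"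
      by (intro mult_right_mono; simp)+
    moreover have "?x * ?e = link_prob N \<zeta> \<alpha> \<beta> (r N)"
      by (simp add: exp_minus)
    ultimately have "good N (r N)"
      by (simp only: good_def mult.assoc[of _ K] simp_thms)
    then have "good N s" if "a * disc_radius \<zeta> N \<le> s" for s
      using that by (rule good)
    then show ?case
      by (simp add: good_def K_def)
  qed
qed

section \<open>The degree distribution\<close>

theorem theorem1p4:
  fixes \<zeta> \<alpha> \<beta> \<epsilon> :: real
  assumes "0 < \<zeta>" and "\<zeta> < 2" and "0 < \<alpha>"
    and "0 < \<beta>" and "\<beta> < 1"
    and "0 < \<zeta> / \<alpha>" and "\<zeta> / \<alpha> < 2"
    and "0 < \<epsilon>"
  shows "\<forall>\<^sub>F N in sequentially. \<forall>u<N.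
    AE G in hyp_graph N \<zeta> \<alpha> \<beta>.
      vertex_type N \<zeta> u G \<le> \<zeta> * disc_radius \<zeta> N / (2 * \<alpha>) \<longrightarrow>
      approx_Bin
        (cond_tail (hyp_graph N \<zeta> \<alpha> \<beta>) (vertex_type N \<zeta> u) (vertex_degree N u) G)
        \<epsilon> (N - 1)
        (K_const \<zeta> \<alpha> \<beta> * (exp (\<zeta> * vertex_type N \<zeta> u G / 2) / real N) powr \<beta>)"
proof -
  \<comment> \<open>The bound on the type says that the radius is at least
    \<open>a * disc_radius \<zeta> N\<close>.\<close>
  define a where "a = 1 - \<zeta> / (2 * \<alpha>)"
  have a: "0 < a" using assms by (simp add: a_def field_simps)
  have "\<beta> * \<zeta> < 1 * \<zeta>" using assms by (intro mult_strict_right_mono) auto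
  also have "1 * \<zeta> < 2 * \<alpha>" using assms by (simp add: field_simps)
  finally have "\<beta> * \<zeta> < 2 * \<alpha>" .
  from eventually_link_prob_bounds[OF assms(1,3,4,5) this a assms(8)] eventually_gt_at_top[of 1]
  show ?thesis
  proof eventually_elim
    case (elim N)
    let ?R = "disc_radius \<zeta> N"
    have powr_eq: "(exp (\<zeta> * t / 2) / real N) powr \<beta> = exp (- (\<beta> * \<zeta> / 2 * (?R - t)))" for t
    proof -
      have "exp (\<zeta> * t / 2) / real N = exp (\<zeta> * t / 2 - \<zeta> * ?R / 2)"
        using exp_disc_radius[of \<zeta> N] assms(1) elim(2) by (simp add: exp_diff)
      moreover have "(\<zeta> * t / 2 - \<zeta> * ?R / 2) * \<beta> = - (\<beta> * \<zeta> / 2 * (?R - t))"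
        by (simp add: field_simps)
      ultimately show ?thesis by (simp only: exp_powr_real)
    qed
    show ?case
    proof (intro allI impI)
      fix u assume u: "u < N"
      \<comment> \<open>Countably many null sets, one for each \<open>k\<close>, are merged so that
        a single exceptional set serves the whole tail function.\<close>
      have "AE G in hyp_graph N \<zeta> \<alpha> \<beta>. \<forall>k.
          cond_tail (hyp_graph N \<zeta> \<alpha> \<beta>) (vertex_type N \<zeta> u) (vertex_degree N u) G k =
          measure_pmf.prob (Bin (N - 1) (link_prob N \<zeta> \<alpha> \<beta> (?R - vertex_type N \<zeta> u G))) {k..}"
        unfolding AE_all_countable using AE_cond_tail_vertex_degree[OF assms(1,3) elim(2) u]
            by blast
      then show "AE G in hyp_graph N \<zeta> \<alpha> \<beta>. vertex_type N \<zeta> u G \<le> \<zeta> * ?R / (2 * \<alpha>) \<longrightarrow>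
          approx_Bin (cond_tail (hyp_graph N \<zeta> \<alpha> \<beta>) (vertex_type N \<zeta> u) (vertex_degree N u) G)
            \<epsilon> (N - 1) (K_const \<zeta> \<alpha> \<beta> * (exp (\<zeta> * vertex_type N \<zeta> u G / 2) / real N) powr \<beta>)"
      proof eventually_elim
        case tail: (elim G)
        show ?case
        proof
          assume "vertex_type N \<zeta> u G \<le> \<zeta> * ?R / (2 * \<alpha>)"
          then have "a * ?R \<le> ?R - vertex_type N \<zeta> u G" by (simp add: a_def algebra_simps)
          with elim(1) show "approx_Bin (cond_tail (hyp_graph N \<zeta> \<alpha> \<beta>) (vertex_type N \<zeta> u)
              (vertex_degree N u) G)
              \<epsilon> (N - 1) (K_const \<zeta> \<alpha> \<beta> * (exp (\<zeta> * vertex_type N \<zeta> u G / 2) / real N) powr \<beta>)"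
            by (simp add: approx_Bin_def tail powr_eq prob_Bin_atLeast_mono)
        qed
      qed
    qed
  qed
qed

end
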